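(* Let $A$ be a unital $C^*$-algebra, $m\ge1$, and $\alpha:\mathbb{Z}^m\to\mathrm{Aut}(A)$ a group action. Suppose there exists $d\in\mathbb{N}$ such that for each $i\in\{1,\dots,m\}$ the following holds: for every $\varepsilon>0$, $p\in\mathbb{N}$ and finite subset $F\subseteq A$, there exist positive contractions $\{g_{i,k}^{(\ell)}:0\le k\le p-1,\ 0\le\ell\le d\}$ in $A$ such that (1) $\|\alpha^i(g_{i,k}^{(\ell)})-g_{i,(k+1 \bmod p)}^{(\ell)}\|<\varepsilon$ for $0\le k\le p-1$, $0\le\ell\le d$; (2) $\|\alpha^j(g_{i,k}^{(\ell)})-g_{i,k}^{(\ell)}\|<\varepsilon$ for $1\le j\le m$, $j\ne i$, $0\le k\le p-1$, $0\le\ell\le d$; (3) $\|[g_{i,k}^{(\ell)},x]\|<\varepsilon$ for $0\le k\le p-1$, $0\le\ell\le d$, $x\in F$; (4) $\|g_{i,k}^{(\ell)}g_{i,n}^{(\ell)}\|<\varepsilon$ for $0\le k\ne n\le p-1$, $0\le\ell\le d$; (5) $\big\|\sum_{k,\ell}g_{i,k}^{(\ell)}-1_A\big\|<\varepsilon$. Then $\dim_{\mathrm{Rok}}(\alpha)\le(d+1)^m-1$.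
   Context: $\alpha^v:=\alpha(v)$ for $v\in\mathbb{Z}^m$; for $1\le i\le m$, $\alpha^i$ means $\alpha^{\xi_i}$, where $\xi_1,\dots,\xi_m$ are the standard generators of $\mathbb{Z}^m$. Rokhlin dimension: for $n\in\mathbb{N}$ let $B_n=\{0,1,\dots,n-1\}^m\subseteq\mathbb{Z}^m$; $v+w \bmod n\mathbb{Z}^m$ denotes the representative in $B_n$. We write $\dim_{\mathrm{Rok}}(\alpha)\le D$ if for any finite subset $F\subseteq A$, $\varepsilon>0$ and $n\in\mathbb{N}$ there exist positive contractions $(f_v^{(\ell)})_{v\in B_n}^{\ell=0,\dots,D}$ in $A$ such that: (1) $\|\alpha^w(f_v^{(\ell)})-f^{(\ell)}_{(v+w \bmod n\mathbb{Z}^m)}\|<\varepsilon$ for $0\le\ell\le D$, $v\in B_n$, $w\in\mathbb{Z}^m$; (2) $\|f_v^{(\ell)}f_{v'}^{(\ell)}\|<\varepsilon$ for $0\le \ell\le D$ and $v\ne v'$ in $B_n$; (3) $\|[f_v^{(\ell)},a]\|<\varepsilon$ for all $\ell$, $v\in B_n$, $a\in F$; (4) $\|\sum_{\ell=0}^D\sum_{v\in B_n}f_v^{(\ell)}-1_A\|<\varepsilon$.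
   Formalization: In dim_Rok, condition (1) is required only for w in an arbitrary finite subset of Z^m fixed before the f_v are chosen (for all w at once the claim fails, e.g. for the 2-adic odometer with n=3), and n, p are at least 1. *)

theory Defs
  imports "HOL-Analysis.Analysis"
begin

class scaleC =
  fixes scaleC :: "complex \<Rightarrow> 'a \<Rightarrow> 'a"  (infixr \<open>*\<^sub>C\<close> 75)

text \<open>
  Unital complex C*-algebras. The class is built on \<^class>\<open>monoid_mult\<close> rather than on
  \<^class>\<open>real_normed_algebra_1\<close>, so that the zero algebra is allowed; in all other cases
  the unit has norm one by the C*-identity.
\<close>

class unital_cstar_algebra = real_normed_algebra + banach + monoid_mult + scaleC +
  fixes adj :: "'a \<Rightarrow> 'a"
  assumes scaleR_scaleC: "r *\<^sub>R x = complex_of_real r *\<^sub>C x"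
    and scaleC_add_right: "c *\<^sub>C (x + y) = c *\<^sub>C x + c *\<^sub>C y"
    and scaleC_add_left: "(b + c) *\<^sub>C x = b *\<^sub>C x + c *\<^sub>C x"
    and scaleC_scaleC: "b *\<^sub>C c *\<^sub>C x = (b * c) *\<^sub>C x"
    and mult_scaleC_left: "(c *\<^sub>C x) * y = c *\<^sub>C (x * y)"
    and mult_scaleC_right: "x * (c *\<^sub>C y) = c *\<^sub>C (x * y)"
    and norm_scaleC: "norm (c *\<^sub>C x) = cmod c * norm x"
    and adj_adj: "adj (adj x) = x"
    and adj_add: "adj (x + y) = adj x + adj y"
    and adj_scaleC: "adj (c *\<^sub>C x) = cnj c *\<^sub>C adj x"
    and adj_mult: "adj (x * y) = adj y * adj x"
    and cstar_identity: "norm (adj x * x) = (norm x)\<^sup>2"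

definition cstar_spectrum :: "'a::unital_cstar_algebra \<Rightarrow> complex set" where
  "cstar_spectrum a = {c. \<not> (\<exists>b. b * (c *\<^sub>C 1 - a) = 1 \<and> (c *\<^sub>C 1 - a) * b = 1)}"

definition cstar_positive :: "'a::unital_cstar_algebra \<Rightarrow> bool" where
  "cstar_positive a \<longleftrightarrow> adj a = a \<and> cstar_spectrum a \<subseteq> complex_of_real ` {0..}"

definition positive_contraction :: "'a::unital_cstar_algebra \<Rightarrow> bool" where
  "positive_contraction a \<longleftrightarrow> cstar_positive a \<and> norm a \<le> 1"

definition commutator :: "'a::unital_cstar_algebra \<Rightarrow> 'a \<Rightarrow> 'a" where
  "commutator a b = a * b - b * a"

definition star_automorphism :: "('a::unital_cstar_algebra \<Rightarrow> 'a) \<Rightarrow> bool" where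
  "star_automorphism \<phi> \<longleftrightarrow> bij \<phi> \<and>
     (\<forall>x y. \<phi> (x + y) = \<phi> x + \<phi> y) \<and>
     (\<forall>c x. \<phi> (c *\<^sub>C x) = c *\<^sub>C \<phi> x) \<and>
     (\<forall>x y. \<phi> (x * y) = \<phi> x * \<phi> y) \<and>
     (\<forall>x. \<phi> (adj x) = adj (\<phi> x))"

text \<open>
  The group of integer vectors of length \<open>m\<close> is \<open>int ^ 'm\<close> with \<open>m = CARD('m)\<close>; its standard
  generators are the vectors \<open>axis i 1\<close>.
\<close>

definition group_action :: "(int ^ 'm::finite \<Rightarrow> 'a::unital_cstar_algebra \<Rightarrow> 'a) \<Rightarrow> bool" where
  "group_action \<alpha> \<longleftrightarrow>
     (\<forall>v. star_automorphism (\<alpha> v)) \<and> (\<forall>v w. \<alpha> (v + w) = \<alpha> v \<circ> \<alpha> w)"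

definition rok_box :: "nat \<Rightarrow> (int ^ 'm::finite) set" where
  "rok_box n = {v. \<forall>i. 0 \<le> v $ i \<and> v $ i < int n}"

definition vmod :: "int ^ 'm::finite \<Rightarrow> nat \<Rightarrow> int ^ 'm" where
  "vmod v n = (\<chi> i. v $ i mod int n)"

text \<open>
  \<open>rokhlin_dim_le \<alpha> D\<close> states that the Rokhlin dimension of \<open>\<alpha>\<close> is at most \<open>D\<close>.
  As usual for approximation properties, the group elements \<open>w\<close> in the first condition range
  over an arbitrary finite set that, like the finite set \<open>F\<close>, is prescribed before the towers
  are chosen. Demanding one family of towers for all \<open>w\<close> simultaneously would be
  uniform almost-invariance under the vectors divisible by \<open>n\<close>, which fails, for instance, for
  the 2-adic odometer with \<open>n = 3\<close>, whose third power is minimal.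
  Tower lengths are positive, since the conditions for \<open>n = 0\<close> would say that the norm of
  the unit is smaller than every positive number.
\<close>

definition rokhlin_dim_le ::
    "(int ^ 'm::finite \<Rightarrow> 'a::unital_cstar_algebra \<Rightarrow> 'a) \<Rightarrow> nat \<Rightarrow> bool" where
  "rokhlin_dim_le \<alpha> D \<longleftrightarrow>
     (\<forall>F W. \<forall>\<epsilon>>0::real. \<forall>n\<ge>1. finite F \<longrightarrow> finite W \<longrightarrow>
       (\<exists>f :: nat \<Rightarrow> int ^ 'm \<Rightarrow> 'a.
          (\<forall>l\<le>D. \<forall>v\<in>rok_box n. positive_contraction (f l v)) \<and>
          (\<forall>l\<le>D. \<forall>v\<in>rok_box n. \<forall>w\<in>W. norm (\<alpha> w (f l v) - f l (vmod (v + w) n)) < \<epsilon>) \<and>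
          (\<forall>l\<le>D. \<forall>v\<in>rok_box n. \<forall>v'\<in>rok_box n. v \<noteq> v' \<longrightarrow> norm (f l v * f l v') < \<epsilon>) \<and>
          (\<forall>l\<le>D. \<forall>v\<in>rok_box n. \<forall>a\<in>F. norm (commutator (f l v) a) < \<epsilon>) \<and>
          norm ((\<Sum>l\<le>D. \<Sum>v\<in>rok_box n. f l v) - 1) < \<epsilon>))"

end

theory Submission
  imports Defs
begin

text \<open>
  For exact and commuting towers the result is clear: if \<open>g\<^sub>i\<close> are towers of height \<open>n\<close> in direction \<open>i\<close>, then
  the products of one element from each direction, indexed by a point \<open>v\<close> of the box and by one label per
  direction, form \<open>(d + 1)^m\<close> towers for the whole group. The generator \<open>i\<close> shifts the \<open>i\<close>-th factor and
  fixes the others, different points have orthogonal factors, and the sum over all indices is the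
  product of the sums, which are all 1.
  
  The towers in different directions commute only approximately. They are chosen one direction after
  the other, each time almost commuting with the finitely many elements chosen before
  (\<open>towers_insert\<close>). The norm conditions survive small perturbations, but a product of almost commuting
  positive contractions need not be positive. It has to be replaced by a positive contraction nearby,
  at a distance controlled by the norm of the commutator alone (\<open>near_product_uniform\<close>).
  
  This replacement rests on a description of positive contractions as the self-adjoint \<open>a\<close> with
  \<open>norm a \<le> 1\<close> and \<open>norm (1 - a) \<le> 1\<close> (\<open>positive_contraction_iff\<close>), which in turn needs the norm of a
  self-adjoint element to be determined by its spectrum (\<open>norm_le_of_resolvent\<close>). The latter is derived from the
  C*-identity and from square roots that are obtained as fixed points of contractions. It also shows that
  automorphisms are contractive, so that errors on generators add up along words
  (\<open>group_action_word\<close>).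
\<close>

section \<open>Inverses and square roots\<close>

lemma adj_diff: "adj (x - y) = adj x - adj (y :: 'a::unital_cstar_algebra)"
  by (metis adj_add add_diff_cancel_right' diff_add_cancel)

lemma adj_one [simp]: "adj 1 = (1 :: 'a::unital_cstar_algebra)"
  by (metis adj_adj adj_mult mult.left_neutral mult.right_neutral)

lemma adj_scaleR: "adj (r *\<^sub>R x) = r *\<^sub>R adj (x :: 'a::unital_cstar_algebra)"
  by (simp add: scaleR_scaleC adj_scaleC)

lemma norm_adj [simp]: "norm (adj x) = norm (x :: 'a::unital_cstar_algebra)"
proof -
  have *: "norm y \<le> norm (adj y)" for y :: 'a
  proof (cases "norm y = 0")
    case False
    have "(norm y)\<^sup>2 \<le> norm (adj y) * norm y"
      by (metis cstar_identity norm_mult_ineq)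
    then show ?thesis
      using False by (simp add: power2_eq_square)
  qed simp
  show ?thesis
    using *[of x] *[of "adj x"] by (simp add: adj_adj)
qed

text \<open>
  The unit of a nonzero algebra has norm one; only the inequality survives in the zero algebra.
\<close>

lemma norm_one_le: "norm (1 :: 'a::unital_cstar_algebra) \<le> 1"
proof -
  have "norm (1::'a) = (norm (1::'a))\<^sup>2"
    using cstar_identity[of "1::'a"] by simp
  then show ?thesis
    by (metis mult_cancel_left1 norm_ge_zero order.refl power2_eq_square zero_less_one_class.zero_le_one)
qed

lemma norm_scaleR_one_le: "norm (r *\<^sub>R (1 :: 'a::unital_cstar_algebra)) \<le> \<bar>r\<bar>"
  using mult_left_mono[OF norm_one_le, of "\<bar>r\<bar>"] by simp

lemma continuous_on_adj: "continuous_on S (adj :: 'a::unital_cstar_algebra \<Rightarrow> 'a)"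
proof -
  have "bounded_linear (adj :: 'a \<Rightarrow> 'a)"
    by (rule bounded_linear_intro[where K=1]) (simp_all add: adj_add adj_scaleR)
  then show ?thesis
    by (rule linear_continuous_on)
qed

definition inverse_pair :: "'a::unital_cstar_algebra \<Rightarrow> 'a \<Rightarrow> bool" where
  "inverse_pair a b \<longleftrightarrow> a * b = 1 \<and> b * a = 1"

lemma left_right_inverse_eq:
  "b * a = 1 \<Longrightarrow> a * c = 1 \<Longrightarrow> b = (c :: 'a::unital_cstar_algebra)"
  by (metis mult.assoc mult.left_neutral mult.right_neutral)

lemma inverse_pair_mult:
  "inverse_pair a b \<Longrightarrow> inverse_pair c d \<Longrightarrow> inverse_pair (a * c) (d * b)"
  unfolding inverse_pair_def by (metis mult.assoc mult.right_neutral)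

lemma inverse_pair_scaleR:
  "inverse_pair a b \<Longrightarrow> r \<noteq> 0 \<Longrightarrow> inverse_pair (r *\<^sub>R a) (inverse r *\<^sub>R b)"
  unfolding inverse_pair_def by simp

lemma inverse_pair_scaleC:
  "inverse_pair a b \<Longrightarrow> r \<noteq> 0 \<Longrightarrow> inverse_pair (r *\<^sub>C a) (inverse r *\<^sub>C b)"
  unfolding inverse_pair_def
  by (simp add: mult_scaleC_left mult_scaleC_right scaleC_scaleC)
     (metis scaleR_scaleC of_real_1 scaleR_one)

lemma inverse_pair_commute:
  assumes "inverse_pair a b" and "x * a = a * x"
  shows "x * b = b * x"
  using assms unfolding inverse_pair_def by (metis mult.assoc mult.left_neutral mult.right_neutral)

lemma inverse_pair_adj:
  assumes "inverse_pair a b" and "adj a = a"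
  shows "adj b = b"
  using assms unfolding inverse_pair_def by (metis adj_mult adj_one left_right_inverse_eq)

text \<open>
  The inverse is found as a fixed point: \<open>(1 - x) b = 1\<close> says that \<open>b\<close> is fixed by the contraction
  \<open>b \<mapsto> 1 + x b\<close>. A left inverse arises in the same way, and it agrees with the right inverse.
\<close>

lemma neumann:
  fixes x :: "'a::unital_cstar_algebra"
  assumes x: "norm x < 1"
  shows "\<exists>b. inverse_pair (1 - x) b \<and> norm b \<le> 1 / (1 - norm x)"
proof -
  have "\<exists>!b. 1 + x * b = b"
    by (rule banach_fix_type[where c="norm x"])
       (use x in \<open>auto simp: dist_norm norm_mult_ineq simp flip: right_diff_distrib\<close>)
  then obtain b where b: "1 + x * b = b" by blast
  have "\<exists>!b. 1 + b * x = b"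
    by (rule banach_fix_type[where c="norm x"])
       (use x norm_mult_ineq in \<open>auto simp: dist_norm mult.commute[of "norm x"]
          simp flip: left_diff_distrib\<close>)
  then obtain b' where b': "1 + b' * x = b'" by blast
  have 1: "(1 - x) * b = 1" using b by (metis add_diff_cancel_right' left_diff_distrib mult.left_neutral)
  have 2: "b' * (1 - x) = 1" using b' by (metis add_diff_cancel_right' right_diff_distrib mult.right_neutral)
  have "b' = b" using 1 2 by (metis left_right_inverse_eq)
  moreover have "norm b \<le> 1 + norm x * norm b"
    using norm_triangle_ineq[of 1 "x * b"] norm_mult_ineq[of x b] norm_one_le[where 'a='a] b by simp
  then have "norm b \<le> 1 / (1 - norm x)"
    using x by (simp add: field_simps)
  ultimately show ?thesis using 1 2 unfolding inverse_pair_def by blast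
qed

lemma neumann_scaleR:
  fixes x :: "'a::unital_cstar_algebra"
  assumes "norm x < r"
  shows "\<exists>b. inverse_pair (r *\<^sub>R 1 - x) b \<and> norm b \<le> 1 / (r - norm x)"
proof -
  have r: "r > 0" using assms norm_ge_zero[of x] by linarith
  obtain b where b: "inverse_pair (1 - (1/r) *\<^sub>R x) b" "norm b \<le> 1 / (1 - norm ((1/r) *\<^sub>R x))"
    using neumann[of "(1/r) *\<^sub>R x"] assms r by auto
  have "inverse_pair (r *\<^sub>R 1 - x) (inverse r *\<^sub>R b)"
    using inverse_pair_scaleR[OF b(1), of r] r by (simp add: scaleR_diff_right)
  moreover have "norm (inverse r *\<^sub>R b) \<le> 1 / (r - norm x)"
    using b(2) r assms by (simp add: field_simps)
  ultimately show ?thesis by blast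
qed

text \<open>
  Write \<open>a + e = a (1 + b e)\<close> and invert the second factor by the Neumann argument.
\<close>

lemma inverse_pair_perturb:
  fixes a :: "'a::unital_cstar_algebra"
  assumes ab: "inverse_pair a b" and e: "norm b * norm e < 1"
  shows "\<exists>b'. inverse_pair (a + e) b' \<and> norm b' \<le> norm b / (1 - norm b * norm e)"
proof -
  have le: "norm (- (b * e)) \<le> norm b * norm e" by (simp add: norm_mult_ineq)
  obtain c where c: "inverse_pair (1 - (- (b * e))) c" "norm c \<le> 1 / (1 - norm (- (b * e)))"
    using neumann[of "- (b * e)"] le e by auto
  have eq: "a * (1 - (- (b * e))) = a + e"
    using ab unfolding inverse_pair_def by (simp add: distrib_left flip: mult.assoc)
  have "norm c \<le> 1 / (1 - norm b * norm e)"
    using c(2) le e by (meson diff_left_mono diff_gt_0_iff_gt frac_le order.trans order_refl zero_le_one)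
  then have "norm (c * b) \<le> (1 / (1 - norm b * norm e)) * norm b"
    by (meson mult_right_mono norm_ge_zero norm_mult_ineq order.trans)
  then show ?thesis
    using inverse_pair_mult[OF ab c(1)] unfolding eq by auto
qed

text \<open>
  Substituting \<open>s = 1 - r\<close> turns \<open>s\<^sup>2 = 1 - y\<close> into the fixed point equation \<open>r = (y + r\<^sup>2) / 2\<close>. The
  right-hand side is a contraction of the ball of radius \<open>1 - sqrt (1 - norm y)\<close>, and it preserves the
  closed set of self-adjoint elements of that ball which commute with the commutant of \<open>y\<close>.
\<close>

lemma sqrt_one_minus:
  fixes y :: "'a::unital_cstar_algebra"
  assumes y: "norm y < 1" and sa: "adj y = y"
  shows "\<exists>s. adj s = s \<and> s * s = 1 - y \<and> (\<forall>x. x * y = y * x \<longrightarrow> x * s = s * x)"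
proof -
  define \<rho> where "\<rho> = 1 - sqrt (1 - norm y)"
  have \<rho>: "0 \<le> \<rho>" "\<rho> < 1" using y unfolding \<rho>_def by auto
  have \<rho>2: "norm y + \<rho> * \<rho> = 2 * \<rho>"
    using y real_sqrt_mult_self[of "1 - norm y"] unfolding \<rho>_def by (simp add: algebra_simps)
  define K where "K = {r. norm r \<le> \<rho>} \<inter> {r. adj r = r} \<inter> (\<Inter>x\<in>{x. x * y = y * x}. {r. x * r = r * x})"
  define f where "f = (\<lambda>r. (1/2) *\<^sub>R (y + r * r))"
  have K_D: "norm r \<le> \<rho>" "adj r = r" "x * y = y * x \<Longrightarrow> x * r = r * x" if "r \<in> K" for r x
    using that unfolding K_def by blast+
  have K_I: "r \<in> K" if "norm r \<le> \<rho>" "adj r = r" "\<And>x. x * y = y * x \<Longrightarrow> x * r = r * x" for r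
    using that unfolding K_def by blast
  have "closed K"
    unfolding K_def
    by (intro closed_Int closed_INT ballI closed_Collect_eq closed_Collect_le continuous_intros
          continuous_on_adj)
  then have "complete K" by (simp add: complete_eq_closed)
  moreover have "0 \<in> K"
    using \<rho> adj_diff[of "0::'a" 0] by (intro K_I) auto
  moreover have "f r \<in> K" if r: "r \<in> K" for r
  proof -
    note n = K_D(1)[OF r]
    have "norm (y + r * r) \<le> norm y + \<rho> * \<rho>"
      by (meson n \<rho>(1) add_left_mono mult_mono norm_ge_zero norm_mult_ineq norm_triangle_le order_trans)
    then have "norm (f r) \<le> \<rho>" using \<rho>2 by (simp add: f_def)
    moreover have "adj (f r) = f r"
      using K_D(2)[OF r] sa by (simp add: f_def adj_scaleR adj_add adj_mult)
    moreover have "x * f r = f r * x" if "x * y = y * x" for x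
    proof -
      have "x * r = r * x" using K_D(3)[OF r that] .
      then have "x * (r * r) = r * r * x" by (metis mult.assoc)
      then show ?thesis using that by (simp add: f_def distrib_left distrib_right)
    qed
    ultimately show ?thesis by (rule K_I)
  qed
  moreover have "dist (f r) (f r') \<le> \<rho> * dist r r'" if "r \<in> K" "r' \<in> K" for r r'
  proof -
    note n = K_D(1)[OF that(1)] K_D(1)[OF that(2)]
    have "f r - f r' = (1/2) *\<^sub>R (r * (r - r') + (r - r') * r')"
      by (simp add: f_def algebra_simps)
    moreover have "norm (r * (r - r') + (r - r') * r') \<le> \<rho> * norm (r - r') + norm (r - r') * \<rho>"
      by (meson n \<rho>(1) add_mono mult_mono norm_ge_zero norm_mult_ineq norm_triangle_le order_refl order_trans)
    ultimately show ?thesis by (simp add: dist_norm)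
  qed
  ultimately have "\<exists>!r. r \<in> K \<and> f r = r"
    using \<rho> by (intro Banach_fix[where c=\<rho>]) auto
  then obtain r where r: "r \<in> K" "f r = r" by blast
  have "2 *\<^sub>R r = 2 *\<^sub>R f r" by (simp only: r(2))
  then have "y + r * r = 2 *\<^sub>R r" by (simp add: f_def)
  then have "(1 - r) * (1 - r) = 1 - y"
    by (simp add: algebra_simps scaleR_2)
  moreover have "adj (1 - r) = 1 - r" using K_D(2)[OF r(1)] by (simp add: adj_diff)
  moreover have "x * (1 - r) = (1 - r) * x" if "x * y = y * x" for x
    using K_D(3)[OF r(1) that] by (simp add: algebra_simps)
  ultimately show ?thesis by blast
qed

lemma scaleC_simps:
  fixes x :: "'a::unital_cstar_algebra"
  shows "(- c) *\<^sub>C x = - (c *\<^sub>C x)" "1 *\<^sub>C x = x" "0 *\<^sub>C x = 0" "c *\<^sub>C (- x) = - (c *\<^sub>C x)"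
proof -
  show "1 *\<^sub>C x = x" by (metis scaleR_scaleC of_real_1 scaleR_one)
  show z: "0 *\<^sub>C x = 0" by (metis scaleR_scaleC of_real_0 scaleR_zero_left)
  show "(- c) *\<^sub>C x = - (c *\<^sub>C x)"
    by (metis z scaleC_add_left add.right_inverse add_eq_0_iff)
  have "c *\<^sub>C (0::'a) = 0" using scaleC_add_right[of c 0 "0::'a"] by simp
  then show "c *\<^sub>C (- x) = - (c *\<^sub>C x)"
    by (metis scaleC_add_right add.right_inverse add_eq_0_iff)
qed

lemma scaleC_diff_right: "c *\<^sub>C (x - y) = c *\<^sub>C x - c *\<^sub>C (y :: 'a::unital_cstar_algebra)"
  by (metis diff_conv_add_uminus scaleC_add_right scaleC_simps(4))

text \<open>
  The C*-identity for \<open>h + i w\<close>: the mixed terms cancel because \<open>h\<close> and \<open>w\<close> commute.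
\<close>

lemma selfadjoint_i_combination:
  fixes h w :: "'a::unital_cstar_algebra"
  assumes "adj h = h" and "adj w = w" and "h * w = w * h"
  shows "(norm (h + \<i> *\<^sub>C w))\<^sup>2 = norm (h * h + w * w)"
proof -
  have "adj (h + \<i> *\<^sub>C w) * (h + \<i> *\<^sub>C w) = h * h + w * w"
    using assms by (simp add: adj_add adj_scaleC algebra_simps mult_scaleC_left mult_scaleC_right
        scaleC_scaleC scaleC_simps scaleC_diff_right)
  then show ?thesis by (metis cstar_identity)
qed

text \<open>
  Here \<open>h\<close> is the real part of \<open>u = h + i w\<close>, and \<open>u\<close> has norm at most \<open>sqrt \<bar>c\<bar>\<close>.
\<close>

lemma norm_le_of_sum_squares:
  fixes h w :: "'a::unital_cstar_algebra"
  assumes "adj h = h" and "adj w = w" and "h * w = w * h" and c: "h * h + w * w = c *\<^sub>R 1"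
  shows "(norm h)\<^sup>2 \<le> \<bar>c\<bar>"
proof -
  let ?u = "h + \<i> *\<^sub>C w"
  have u: "(norm ?u)\<^sup>2 \<le> \<bar>c\<bar>"
    using selfadjoint_i_combination[OF assms(1-3)] norm_scaleR_one_le c by metis
  have "?u + adj ?u = 2 *\<^sub>R h"
    using assms by (simp add: adj_add adj_scaleC scaleC_simps scaleR_2)
  then have "2 * norm h \<le> norm ?u + norm ?u"
    by (metis norm_adj norm_scaleR abs_numeral norm_triangle_ineq)
  then have "(norm h)\<^sup>2 \<le> (norm ?u)\<^sup>2"
    by (intro power_mono) auto
  with u show ?thesis by linarith
qed

section \<open>Norms and spectra of self-adjoint elements\<close>

text \<open>
  This is the fact that a self-adjoint element has a spectral value of modulus equal to its norm, in a
  form that avoids the spectral radius formula. If \<open>1 - h\<^sup>2\<close> had an inverse, then \<open>z = 1 - t h\<^sup>2\<close> would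
  have inverses of norm below a constant \<open>B\<close> for all \<open>t < 1\<close> near 1. Both \<open>z\<close> and \<open>1 - z\<^sup>-\<^sup>1 / B\<close> have
  square roots; the product \<open>w\<close> of these satisfies \<open>w\<^sup>2 = z - 1 / B\<close>, that is
  \<open>t h\<^sup>2 + w\<^sup>2 = 1 - 1 / B\<close>, whence \<open>t \<le> 1 - 1 / B\<close>. This fails for \<open>t\<close> close to 1.
\<close>

lemma one_minus_square_not_invertible:
  fixes h :: "'a::unital_cstar_algebra"
  assumes sa: "adj h = h" and n: "norm h = 1" and b: "inverse_pair (1 - h * h) b"
  shows False
proof -
  define B where "B = 2 * norm b + 1"
  \<comment> \<open>Close enough to 1 for the perturbed inverse to have norm below \<open>B\<close>, and larger than \<open>1 - 1 / B\<close>.\<close>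
  define t where "t = 1 - 1 / (2 * B)"
  have B: "B \<ge> 1" by (simp add: B_def)
  have t: "0 < t" "t < 1" using B by (simp_all add: t_def field_simps)
  define y where "y = t *\<^sub>R (h * h)"
  have hh: "norm (h * h) = 1" using cstar_identity[of h] sa n by simp
  have y: "norm y < 1" "adj y = y" using t hh sa by (simp_all add: y_def adj_scaleR adj_mult)
  have tb: "norm b * norm ((1 - t) *\<^sub>R (h * h)) \<le> 1 / 2"
  proof -
    have "norm b * norm ((1 - t) *\<^sub>R (h * h)) = norm b / (2 * B)"
      using t hh by (simp add: t_def)
    also have "\<dots> \<le> 1 / 2"
      by (simp add: B_def divide_le_eq add_nonneg_pos)
    finally show ?thesis .
  qed
  obtain bt where bt: "inverse_pair (1 - y) bt"
      "norm bt \<le> norm b / (1 - norm b * norm ((1 - t) *\<^sub>R (h * h)))"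
    using inverse_pair_perturb[OF b, of "(1 - t) *\<^sub>R (h * h)"] tb
    by (auto simp: y_def algebra_simps)
  have "norm b / (1 - norm b * norm ((1 - t) *\<^sub>R (h * h))) \<le> norm b / (1 / 2)"
    using tb by (intro divide_left_mono) auto
  then have ltB: "norm bt < B" using bt(2) by (simp add: B_def)
  have bt_sa: "adj bt = bt"
    using inverse_pair_adj[OF bt(1)] y by (simp add: adj_diff)
  have bt_comm: "x * bt = bt * x" if "x * y = y * x" for x
    using inverse_pair_commute[OF bt(1), of x] that by (simp add: algebra_simps)
  obtain s where s: "adj s = s" "s * s = 1 - y" "\<And>x. x * y = y * x \<Longrightarrow> x * s = s * x"
    using sqrt_one_minus[OF y] by blast
  obtain r where r: "adj r = r" "r * r = 1 - (1 / B) *\<^sub>R bt"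
      "\<And>x. x * bt = bt * x \<Longrightarrow> x * r = r * x"
  proof -
    have "norm ((1 / B) *\<^sub>R bt) < 1" using ltB B by simp
    moreover have "adj ((1 / B) *\<^sub>R bt) = (1 / B) *\<^sub>R bt" using bt_sa by (simp add: adj_scaleR)
    ultimately obtain r where "adj r = r" "r * r = 1 - (1 / B) *\<^sub>R bt"
        and r: "\<And>x. x * ((1 / B) *\<^sub>R bt) = (1 / B) *\<^sub>R bt * x \<Longrightarrow> x * r = r * x"
      using sqrt_one_minus by blast
    moreover have "x * r = r * x" if "x * bt = bt * x" for x
      by (rule r) (simp only: mult_scaleR_left mult_scaleR_right that)
    ultimately show thesis using that by blast
  qed
  have hy: "h * y = y * h" by (simp add: y_def mult.assoc)
  have sr: "s * r = r * s" by (rule r(3)[OF bt_comm]) (rule s(3)[symmetric], rule refl)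
  have hs: "h * s = s * h" using s(3)[OF hy] .
  have hr: "h * r = r * h" using r(3)[OF bt_comm[OF hy]] .
  have hsr: "h * (s * r) = s * r * h"
    by (metis hs hr mult.assoc)
  have "(s * r) * (s * r) = (s * s) * (r * r)" by (metis sr mult.assoc)
  also have "\<dots> = (1 - y) - (1 / B) *\<^sub>R 1"
    using bt(1) by (simp add: s r right_diff_distrib inverse_pair_def)
  finally have w: "(s * r) * (s * r) = (1 - y) - (1 / B) *\<^sub>R 1" .
  have "(norm (sqrt t *\<^sub>R h))\<^sup>2 \<le> \<bar>1 - 1 / B\<bar>"
  proof (rule norm_le_of_sum_squares)
    show "adj (sqrt t *\<^sub>R h) = sqrt t *\<^sub>R h" by (simp add: adj_scaleR sa)
    show "adj (s * r) = s * r" by (simp add: adj_mult s r sr)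
    show "sqrt t *\<^sub>R h * (s * r) = s * r * sqrt t *\<^sub>R h" by (simp add: hsr)
    show "sqrt t *\<^sub>R h * sqrt t *\<^sub>R h + s * r * (s * r) = (1 - 1 / B) *\<^sub>R 1"
      using t unfolding w by (simp add: y_def scaleR_diff_left)
  qed
  then have "t \<le> 1 - 1 / B" using t B n by (simp add: power_mult_distrib)
  then show False using B by (simp add: t_def field_simps)
qed

text \<open>
  A number \<open>t = norm h > R\<close> would make both \<open>1 - h / t\<close> and \<open>1 + h / t\<close> invertible, hence also their
  product \<open>1 - (h / t)\<^sup>2\<close>, although \<open>h / t\<close> has norm one.
\<close>

lemma norm_le_of_resolvent:
  fixes h :: "'a::unital_cstar_algebra"
  assumes sa: "adj h = h" and R: "R \<ge> 0"
    and res: "\<And>t. \<bar>t\<bar> > R \<Longrightarrow> \<exists>b. inverse_pair (t *\<^sub>R 1 - h) b"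
  shows "norm h \<le> R"
proof (rule ccontr)
  assume "\<not> norm h \<le> R"
  then have n: "norm h > R" "norm h > 0" using R by auto
  let ?t = "norm h"
  let ?h = "inverse ?t *\<^sub>R h"
  have 1: "?t *\<^sub>R 1 - h = ?t *\<^sub>R (1 - ?h)" and 2: "(- ?t) *\<^sub>R 1 - h = (- ?t) *\<^sub>R (1 + ?h)"
    using n by (simp_all add: scaleR_diff_right scaleR_add_right)
  obtain b where "inverse_pair (?t *\<^sub>R 1 - h) b" using res[of ?t] n by auto
  from inverse_pair_scaleR[OF this, of "inverse ?t"]
  have b: "inverse_pair (1 - ?h) (?t *\<^sub>R b)" using n unfolding 1 by simp
  obtain c where "inverse_pair ((- ?t) *\<^sub>R 1 - h) c" using res[of "- ?t"] n by auto
  from inverse_pair_scaleR[OF this, of "- inverse ?t"]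
  have c: "inverse_pair (1 + ?h) (- ?t *\<^sub>R c)" using n unfolding 2 by (simp add: add.commute)
  have "(1 - ?h) * (1 + ?h) = 1 - ?h * ?h" by (simp add: algebra_simps)
  then have "inverse_pair (1 - ?h * ?h) ((- ?t *\<^sub>R c) * (?t *\<^sub>R b))"
    using inverse_pair_mult[OF b c] by metis
  moreover have "adj ?h = ?h" "norm ?h = 1" using n by (simp_all add: adj_scaleR sa)
  ultimately show False using one_minus_square_not_invertible by blast
qed

lemma neumann_scaleC:
  fixes x :: "'a::unital_cstar_algebra"
  assumes "norm x < cmod c"
  shows "\<exists>b. inverse_pair (c *\<^sub>C 1 - x) b"
proof -
  have c: "c \<noteq> 0" using assms by auto
  have "norm (inverse c *\<^sub>C x) = norm x / cmod c"
    by (simp only: norm_scaleC norm_inverse) (simp add: field_class.field_divide_inverse mult.commute)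
  then have "norm (inverse c *\<^sub>C x) < 1"
    using assms c by simp
  then obtain b where "inverse_pair (1 - inverse c *\<^sub>C x) b" using neumann by blast
  from inverse_pair_scaleC[OF this c] c show ?thesis
    by (auto simp: scaleC_diff_right scaleC_scaleC scaleC_simps)
qed

text \<open>
  Arens' trick: translating by \<open>i t\<close> moves the number by \<open>t\<close> along the imaginary axis, whereas the squared
  norm of the self-adjoint element grows by \<open>t\<^sup>2\<close> only. A suitable \<open>t\<close> puts the number outside the disc
  whose radius is the norm.
\<close>

lemma selfadjoint_resolvent_nonreal:
  fixes h :: "'a::unital_cstar_algebra"
  assumes sa: "adj h = h" and c: "Im c \<noteq> 0"
  shows "\<exists>b. inverse_pair (c *\<^sub>C 1 - h) b"
proof -
  define k where "k = h - Re c *\<^sub>R 1"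
  define t where "t = (norm k)\<^sup>2 / (2 * Im c)"
  have "adj k = k" by (simp add: k_def adj_diff adj_scaleR sa)
  then have "(norm (k + \<i> *\<^sub>C (t *\<^sub>R 1)))\<^sup>2 = norm (k * k + (t *\<^sub>R 1) * (t *\<^sub>R 1))"
    by (intro selfadjoint_i_combination) (simp_all add: adj_scaleR)
  also have "\<dots> \<le> norm (k * k) + norm ((t * t) *\<^sub>R (1::'a))"
    using norm_triangle_ineq[of "k * k" "(t * t) *\<^sub>R 1"] by simp
  also have "\<dots> \<le> (norm k)\<^sup>2 + t\<^sup>2"
    using norm_mult_ineq[of k k] norm_scaleR_one_le[of "t * t", where 'a='a] by (simp add: power2_eq_square)
  also have "\<dots> < (Im c + t)\<^sup>2"
    using c by (simp add: t_def power2_sum)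
  finally have "(norm (k + \<i> *\<^sub>C (t *\<^sub>R 1)))\<^sup>2 < \<bar>Im c + t\<bar>\<^sup>2" by simp
  then have "norm (k + \<i> *\<^sub>C (t *\<^sub>R 1)) < \<bar>Im c + t\<bar>"
    by (rule power2_less_imp_less) simp
  also have "\<bar>Im c + t\<bar> = cmod (\<i> * complex_of_real (Im c + t))" by (simp only: norm_mult norm_of_real) simp
  finally obtain b where b: "inverse_pair ((\<i> * complex_of_real (Im c + t)) *\<^sub>C 1 - (k + \<i> *\<^sub>C (t *\<^sub>R 1))) b"
    using neumann_scaleC by blast
  have "c *\<^sub>C (1::'a) = complex_of_real (Re c) *\<^sub>C 1 + (\<i> * complex_of_real (Im c)) *\<^sub>C 1"
    using complex_eq[of c] by (metis scaleC_add_left)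
  then have "(\<i> * complex_of_real (Im c + t)) *\<^sub>C 1 - (k + \<i> *\<^sub>C (t *\<^sub>R 1)) = c *\<^sub>C 1 - h"
    by (simp add: k_def scaleR_scaleC scaleC_scaleC scaleC_add_left distrib_left)
  with b show ?thesis by metis
qed

lemma cstar_spectrum_iff: "c \<in> cstar_spectrum a \<longleftrightarrow> \<not> (\<exists>b. inverse_pair (c *\<^sub>C 1 - a) b)"
  unfolding cstar_spectrum_def inverse_pair_def by auto

text \<open>
  Positivity of a contraction is hereby expressed by norms alone. In one direction \<open>1 - a\<close> has no real
  spectral values outside \<open>[-1, 1]\<close>; in the other the spectrum of \<open>a\<close> is real and lies in the disc of
  radius one around 1.
\<close>

lemma positive_contraction_iff:
  "positive_contraction a \<longleftrightarrow> adj a = a \<and> norm a \<le> 1 \<and> norm (1 - a) \<le> 1"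
proof (intro iffI conjI)
  assume pc: "positive_contraction a"
  then show sa: "adj a = a" and n: "norm a \<le> 1"
    by (auto simp: positive_contraction_def cstar_positive_def)
  show "norm (1 - a) \<le> 1"
  proof (rule norm_le_of_resolvent)
    show "adj (1 - a) = 1 - a" by (simp add: adj_diff sa)
    fix t :: real assume t: "\<bar>t\<bar> > 1"
    have "\<exists>b. inverse_pair ((1 - t) *\<^sub>R 1 - a) b"
    proof (cases "t > 1")
      case True
      have "complex_of_real (1 - t) \<notin> cstar_spectrum a"
      proof
        assume "complex_of_real (1 - t) \<in> cstar_spectrum a"
        then obtain r where "r \<ge> 0" "complex_of_real (1 - t) = complex_of_real r"
          using pc unfolding positive_contraction_def cstar_positive_def by blast
        then show False using True by (simp only: of_real_eq_iff)
      qed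
      then show ?thesis by (simp add: cstar_spectrum_iff scaleR_scaleC)
    next
      case False
      then have "norm a < 1 - t" using t n by linarith
      then show ?thesis using neumann_scaleR by blast
    qed
    then obtain b where "inverse_pair ((1 - t) *\<^sub>R 1 - a) b" ..
    from inverse_pair_scaleR[OF this, of "-1"]
    have "inverse_pair (t *\<^sub>R 1 - (1 - a)) (- b)"
      by (simp add: scaleR_diff_left algebra_simps)
    then show "\<exists>b. inverse_pair (t *\<^sub>R 1 - (1 - a)) b" ..
  qed simp
next
  assume a: "adj a = a \<and> norm a \<le> 1 \<and> norm (1 - a) \<le> 1"
  have "c \<in> complex_of_real ` {0..}" if c: "c \<in> cstar_spectrum a" for c
  proof -
    have im: "Im c = 0"
      using a c selfadjoint_resolvent_nonreal by (auto simp: cstar_spectrum_iff)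
    have "Re c \<ge> 0"
    proof (rule ccontr)
      assume "\<not> Re c \<ge> 0"
      then have "norm (1 - a) < 1 - Re c" using a by linarith
      then obtain b where "inverse_pair ((1 - Re c) *\<^sub>R 1 - (1 - a)) b" using neumann_scaleR by blast
      from inverse_pair_scaleR[OF this, of "-1"]
      have "inverse_pair (Re c *\<^sub>R 1 - a) (- b)"
        by (simp add: scaleR_diff_left algebra_simps)
      then have "\<exists>b. inverse_pair (Re c *\<^sub>R 1 - a) b" ..
      moreover have "Re c *\<^sub>R (1::'a) = c *\<^sub>C 1"
        using im by (simp add: scaleR_scaleC complex_is_Real_iff)
      ultimately show False using c by (simp add: cstar_spectrum_iff)
    qed
    moreover have "c = complex_of_real (Re c)" using im by (simp add: complex_eq_iff)
    ultimately show ?thesis by (metis atLeast_iff image_eqI)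
  qed
  then show "positive_contraction a"
    using a by (auto simp: positive_contraction_def cstar_positive_def)
qed

lemma star_automorphism_one: "star_automorphism \<phi> \<Longrightarrow> \<phi> 1 = 1"
  unfolding star_automorphism_def by (metis bij_pointE mult.left_neutral mult.right_neutral)

lemma star_automorphism_diff: "star_automorphism \<phi> \<Longrightarrow> \<phi> (x - y) = \<phi> x - \<phi> y"
  unfolding star_automorphism_def by (metis add_diff_cancel_right' diff_add_cancel)

text \<open>
  An automorphism preserves invertibility of \<open>t 1 - x* x\<close>, and these resolvents control the norm of \<open>x* x\<close>.
\<close>

lemma star_automorphism_contractive:
  assumes \<phi>: "star_automorphism \<phi>"
  shows "norm (\<phi> x) \<le> norm x"
proof -
  have \<phi>': "\<phi> (x * y) = \<phi> x * \<phi> y" "\<phi> (adj x) = adj (\<phi> x)" "\<phi> (r *\<^sub>R x) = r *\<^sub>R \<phi> x" for x y r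
    using \<phi> by (simp_all add: star_automorphism_def scaleR_scaleC)
  note \<phi>' = \<phi>' star_automorphism_one[OF \<phi>] star_automorphism_diff[OF \<phi>]
  let ?h = "adj x * x"
  have "norm (\<phi> ?h) \<le> norm ?h"
  proof (rule norm_le_of_resolvent)
    show "adj (\<phi> ?h) = \<phi> ?h" by (simp add: adj_mult adj_adj flip: \<phi>'(2))
    fix t :: real assume "\<bar>t\<bar> > norm ?h"
    then obtain b where "inverse_pair (complex_of_real t *\<^sub>C 1 - ?h) b"
      using neumann_scaleC[of ?h "complex_of_real t"] by auto
    then have "inverse_pair (\<phi> (t *\<^sub>R 1 - ?h)) (\<phi> b)"
      unfolding inverse_pair_def scaleR_scaleC by (metis \<phi>'(1,4))
    then show "\<exists>b. inverse_pair (t *\<^sub>R 1 - \<phi> ?h) b" by (auto simp: \<phi>'(3-5))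
  qed simp
  then have "(norm (\<phi> x))\<^sup>2 \<le> (norm x)\<^sup>2"
    by (simp add: \<phi>' flip: cstar_identity)
  then show ?thesis by (rule power2_le_imp_le) simp
qed

section \<open>Positive contractions near products\<close>

lemma norm_scaleR_le_one_mult:
  "norm (x :: 'a::unital_cstar_algebra) \<le> 1 \<Longrightarrow> norm (r *\<^sub>R x) \<le> \<bar>r\<bar>"
  using mult_left_mono[of "norm x" 1 "\<bar>r\<bar>"] by simp

text \<open>
  The spectrum of the inverse of \<open>b + \<eta>\<close> lies between \<open>1 / (1 + \<eta>)\<close> and \<open>1 / \<eta>\<close>; the last estimate is
  the lower bound, written as a distance from the upper one. The spectrum is computed from
  \<open>c + s = c (1 + s (b + \<eta>))\<close>, where \<open>c\<close> is the inverse.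
\<close>

lemma positive_contraction_shift_inverse:
  fixes b :: "'a::unital_cstar_algebra"
  assumes b: "positive_contraction b" and \<eta>: "\<eta> > 0"
  shows "\<exists>b'. inverse_pair (b + \<eta> *\<^sub>R 1) b' \<and> norm b' \<le> 1 / \<eta>
    \<and> norm ((1 / \<eta>) *\<^sub>R 1 - b') \<le> 1 / \<eta> - 1 / (1 + \<eta>)"
proof -
  have b': "adj b = b" "norm b \<le> 1" "norm (1 - b) \<le> 1" using b by (simp_all add: positive_contraction_iff)
  have shift: "\<exists>c. inverse_pair (b + r *\<^sub>R 1) c \<and> norm c \<le> 1 / r" if r: "r > 0" for r
  proof -
    obtain c where c: "inverse_pair ((1 + r) *\<^sub>R 1 - (1 - b)) c" "norm c \<le> 1 / (1 + r - norm (1 - b))"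
      using neumann_scaleR[of "1 - b" "1 + r"] b'(3) r by auto
    have "(1 + r) *\<^sub>R 1 - (1 - b) = b + r *\<^sub>R 1" by (simp add: scaleR_add_left)
    moreover have "norm c \<le> 1 / r"
      by (rule order_trans[OF c(2)]) (use b'(3) r in \<open>auto intro!: divide_left_mono mult_pos_pos\<close>)
    ultimately show ?thesis using c(1) by metis
  qed
  let ?b = "b + \<eta> *\<^sub>R 1"
  obtain c where c: "inverse_pair ?b c" "norm c \<le> 1 / \<eta>" using shift[OF \<eta>] by blast
  have c_sa: "adj c = c" using inverse_pair_adj[OF c(1)] b' by (simp add: adj_add adj_scaleR)
  have nb: "norm ?b \<le> 1 + \<eta>"
    using norm_triangle_mono[OF b'(2) norm_scaleR_one_le[of \<eta>]] \<eta> by simp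
  have le: "1 / (1 + \<eta>) \<le> 1 / \<eta>" using \<eta> by (simp add: field_simps)
  have "norm ((1 / \<eta>) *\<^sub>R 1 - c) \<le> 1 / \<eta> - 1 / (1 + \<eta>)"
  proof (rule norm_le_of_resolvent)
    show "adj ((1 / \<eta>) *\<^sub>R 1 - c) = (1 / \<eta>) *\<^sub>R 1 - c" by (simp add: adj_diff adj_scaleR c_sa)
    show "0 \<le> 1 / \<eta> - 1 / (1 + \<eta>)" using le by simp
    fix t assume t: "1 / \<eta> - 1 / (1 + \<eta>) < \<bar>t\<bar>"
    define s where "s = t - 1 / \<eta>"
    have "\<exists>e. inverse_pair (1 + s *\<^sub>R ?b) e"
    proof (cases "\<bar>s\<bar> * (1 + \<eta>) < 1")
      case True
      have "norm (- (s *\<^sub>R ?b)) \<le> \<bar>s\<bar> * (1 + \<eta>)"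
        using nb by (simp add: mult_left_mono)
      then have "norm (- (s *\<^sub>R ?b)) < 1" using True by linarith
      from neumann[OF this] show ?thesis by auto
    next
      case False
      then have big: "\<bar>s\<bar> \<ge> 1 / (1 + \<eta>)" using \<eta> by (simp add: field_simps)
      have s0: "s \<noteq> 0" using False by auto
      have "\<eta> + 1 / s > 0"
      proof (cases "s > 0")
        case True
        then show ?thesis using \<eta> by (simp add: add_pos_pos)
      next
        case neg: False
        then have "t < - (1 / \<eta> - 1 / (1 + \<eta>))" using t big unfolding s_def by linarith
        then have "- s > 1 / \<eta>" using le unfolding s_def by linarith
        then show ?thesis using \<eta> neg s0 by (simp add: field_simps)
      qed
      then obtain e where "inverse_pair (b + (\<eta> + 1 / s) *\<^sub>R 1) e" using shift by blast
      from inverse_pair_scaleR[OF this s0]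
      have "inverse_pair (1 + s *\<^sub>R ?b) (inverse s *\<^sub>R e)"
        using s0 by (simp add: scaleR_add_right scaleR_add_left distrib_left add_ac)
      then show ?thesis ..
    qed
    then obtain e where e: "inverse_pair (1 + s *\<^sub>R ?b) e" ..
    have "inverse_pair c ?b" using c(1) by (simp add: inverse_pair_def)
    from inverse_pair_mult[OF this e] have "inverse_pair (c * (1 + s *\<^sub>R ?b)) (e * ?b)" .
    moreover have "c * ?b = 1" using c(1) by (simp add: inverse_pair_def)
    then have "c * (1 + s *\<^sub>R ?b) = c + s *\<^sub>R 1"
      by (simp only: distrib_left mult_scaleR_right mult.right_neutral)
    moreover have "c + s *\<^sub>R 1 = t *\<^sub>R 1 - ((1 / \<eta>) *\<^sub>R 1 - c)"
      by (simp add: s_def scaleR_diff_left)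
    ultimately show "\<exists>e. inverse_pair (t *\<^sub>R 1 - ((1 / \<eta>) *\<^sub>R 1 - c)) e" by metis
  qed
  with c show ?thesis by blast
qed

text \<open>
  With \<open>b'\<close> the inverse of \<open>b + \<eta>\<close>, factor \<open>a (b + \<eta>) + l = (a + l b') (b + \<eta>)\<close>. The first factor is a sum
  of positive elements, the second of which is bounded below by \<open>l / (1 + \<eta>)\<close>.
\<close>

lemma positive_product_shift_inverse:
  fixes a b :: "'a::unital_cstar_algebra"
  assumes a: "positive_contraction a" and b: "positive_contraction b" and \<eta>: "\<eta> > 0" and l: "l > 0"
  shows "\<exists>c. inverse_pair (a * (b + \<eta> *\<^sub>R 1) + l *\<^sub>R 1) c \<and> norm c \<le> (1 + \<eta>) / (\<eta> * l)"
proof -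
  obtain b' where b': "inverse_pair (b + \<eta> *\<^sub>R 1) b'" "norm b' \<le> 1 / \<eta>"
      "norm ((1 / \<eta>) *\<^sub>R 1 - b') \<le> 1 / \<eta> - 1 / (1 + \<eta>)"
    using positive_contraction_shift_inverse[OF b \<eta>] by blast
  let ?x = "l *\<^sub>R ((1 / \<eta>) *\<^sub>R 1 - b') + (1 - a)"
  have "norm (l *\<^sub>R ((1 / \<eta>) *\<^sub>R 1 - b')) \<le> l * (1 / \<eta> - 1 / (1 + \<eta>))"
    using l b'(3) by simp
  moreover have "norm (1 - a) \<le> 1" using a by (simp add: positive_contraction_iff)
  ultimately have x: "norm ?x \<le> l * (1 / \<eta> - 1 / (1 + \<eta>)) + 1" by (rule norm_triangle_mono)
  have pos: "l / (1 + \<eta>) > 0" using l \<eta> by simp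
  have gap: "l / (1 + \<eta>) \<le> l * (1 / \<eta>) + 1 - norm ?x" using x by (simp add: right_diff_distrib)
  obtain c where c: "inverse_pair ((l * (1 / \<eta>) + 1) *\<^sub>R 1 - ?x) c"
      "norm c \<le> 1 / (l * (1 / \<eta>) + 1 - norm ?x)"
    using neumann_scaleR[of ?x "l * (1 / \<eta>) + 1"] gap pos by auto
  have "norm c \<le> 1 / (l / (1 + \<eta>))"
    by (rule order_trans[OF c(2)], rule divide_left_mono[OF gap])
       (use less_le_trans[OF pos gap] pos in \<open>auto intro: mult_pos_pos simp del: times_divide_eq_right\<close>)
  then have nc: "norm c \<le> (1 + \<eta>) / l" by simp
  have "(l * (1 / \<eta>) + 1) *\<^sub>R 1 - ?x = a + l *\<^sub>R b'"
    by (simp add: scaleR_add_left scaleR_diff_right)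
  then have "inverse_pair ((a + l *\<^sub>R b') * (b + \<eta> *\<^sub>R 1)) (b' * c)"
    using inverse_pair_mult[OF c(1) b'(1)] by metis
  moreover have "b' * (b + \<eta> *\<^sub>R 1) = 1" using b'(1) by (simp add: inverse_pair_def)
  then have "(a + l *\<^sub>R b') * (b + \<eta> *\<^sub>R 1) = a * (b + \<eta> *\<^sub>R 1) + l *\<^sub>R 1"
    by (simp only: distrib_right mult_scaleR_left)
  moreover have "norm (b' * c) \<le> (1 / \<eta>) * ((1 + \<eta>) / l)"
    by (rule order_trans[OF norm_mult_ineq mult_mono]) (use b' nc \<eta> in auto)
  ultimately show ?thesis by (intro exI[of _ "b' * c"]) simp
qed

text \<open>
  The candidate is the symmetrized product \<open>s\<close> of \<open>a\<close> and \<open>b + \<eta>\<close>. It differs from \<open>a (b + \<eta>)\<close> by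
  half a commutator \<open>e\<close>, which is too small to destroy the invertibility of \<open>a (b + \<eta>) + l\<close> for
  \<open>l > \<eta>\<close>. So the spectrum of \<open>s\<close> is at least \<open>- \<eta>\<close>, and after adding \<open>\<eta>\<close> and dividing by
  \<open>1 + 2 \<eta>\<close> one has a positive contraction.
\<close>

lemma near_product:
  fixes a b :: "'a::unital_cstar_algebra"
  assumes a: "positive_contraction a" and b: "positive_contraction b"
    and \<eta>: "0 < \<eta>" "\<eta> \<le> 1" and comm: "norm (a * b - b * a) < \<eta>\<^sup>2"
  shows "\<exists>c. positive_contraction c \<and> norm (c - a * b) \<le> 5 * \<eta>"
proof -
  have a': "adj a = a" "norm a \<le> 1" and b': "adj b = b" "norm b \<le> 1"
    using a b by (simp_all add: positive_contraction_iff)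
  let ?b = "b + \<eta> *\<^sub>R 1"
  define e where "e = (1/2) *\<^sub>R (b * a - a * b)"
  define s where "s = (1/2) *\<^sub>R (a * ?b + ?b * a)"
  define c where "c = (1 / (1 + 2 * \<eta>)) *\<^sub>R (s + \<eta> *\<^sub>R 1)"
  have e: "norm e < \<eta>\<^sup>2 / 2" using comm by (simp add: e_def norm_minus_commute)
  have s_sa: "adj s = s" by (simp add: s_def adj_add adj_mult adj_scaleR a' b' add_ac)
  have "s = (1/2) *\<^sub>R (a * ?b + a * ?b) + e"
    by (simp add: s_def e_def distrib_left distrib_right scaleR_add_right scaleR_diff_right)
  then have s_eq: "s = a * ?b + e" by (simp only: scaleR_half_double)
  have nb: "norm ?b \<le> 1 + \<eta>"
    using norm_triangle_mono[OF b'(2) norm_scaleR_one_le[of \<eta>]] \<eta> by simp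
  have "norm (a * ?b) \<le> 1 * (1 + \<eta>)" "norm (?b * a) \<le> (1 + \<eta>) * 1"
    by (rule order_trans[OF norm_mult_ineq mult_mono]; use a' nb \<eta> in simp)+
  then have "norm (a * ?b + ?b * a) \<le> 2 * (1 + \<eta>)"
    using norm_triangle_mono[of "a * ?b" "1 + \<eta>" "?b * a" "1 + \<eta>"] by simp
  then have ns: "norm s \<le> 1 + \<eta>" by (simp add: s_def)
  have inv: "\<exists>c. inverse_pair (s + l *\<^sub>R 1) c" if l: "l > \<eta>" for l
  proof -
    have l0: "l > 0" using l \<eta> by linarith
    obtain c where c: "inverse_pair (a * ?b + l *\<^sub>R 1) c" "norm c \<le> (1 + \<eta>) / (\<eta> * l)"
      using positive_product_shift_inverse[OF a b \<eta>(1) l0] by blast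
    have "norm c * norm e \<le> ((1 + \<eta>) / (\<eta> * l)) * (\<eta>\<^sup>2 / 2)"
      by (rule mult_mono) (use c e \<eta> l0 in auto)
    also have "\<dots> = ((1 + \<eta>) / 2) * (\<eta> / l)"
      using \<eta> l0 by (simp add: power2_eq_square field_simps)
    also have "\<dots> \<le> 1 * (\<eta> / l)"
      by (rule mult_right_mono) (use \<eta> l0 in auto)
    also have "\<dots> < 1" using l l0 by simp
    finally have "norm c * norm e < 1" .
    from inverse_pair_perturb[OF c(1) this] show ?thesis
      unfolding s_eq by (auto simp: add_ac)
  qed
  have key: "norm ((1 + \<eta>) *\<^sub>R 1 - s) \<le> 1 + 2 * \<eta>"
  proof (rule norm_le_of_resolvent)
    show "adj ((1 + \<eta>) *\<^sub>R 1 - s) = (1 + \<eta>) *\<^sub>R 1 - s" by (simp add: adj_diff adj_scaleR s_sa)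
    show "0 \<le> 1 + 2 * \<eta>" using \<eta> by simp
    fix t assume t: "1 + 2 * \<eta> < \<bar>t\<bar>"
    show "\<exists>c. inverse_pair (t *\<^sub>R 1 - ((1 + \<eta>) *\<^sub>R 1 - s)) c"
    proof (cases "t > 0")
      case True
      then have "t - (1 + \<eta>) > \<eta>" using t by linarith
      moreover have "s + (t - (1 + \<eta>)) *\<^sub>R 1 = t *\<^sub>R 1 - ((1 + \<eta>) *\<^sub>R 1 - s)"
        by (simp only: scaleR_diff_left) simp
      ultimately show ?thesis using inv by metis
    next
      case False
      then have "norm s < 1 + \<eta> - t" using t ns \<eta> by linarith
      then obtain c where "inverse_pair ((1 + \<eta> - t) *\<^sub>R 1 - s) c" using neumann_scaleR by blast
      from inverse_pair_scaleR[OF this, of "-1"]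
      have "inverse_pair (- ((1 + \<eta> - t) *\<^sub>R 1 - s)) (- c)" by simp
      moreover have "- ((1 + \<eta> - t) *\<^sub>R 1 - s) = t *\<^sub>R 1 - ((1 + \<eta>) *\<^sub>R 1 - s)"
        by (simp only: scaleR_diff_left) simp
      ultimately show ?thesis by metis
    qed
  qed
  have "norm (s + \<eta> *\<^sub>R 1) \<le> 1 + 2 * \<eta>"
    using norm_triangle_mono[OF ns norm_scaleR_one_le[of \<eta>]] \<eta> by simp
  then have "norm c \<le> 1" using \<eta> by (simp add: c_def)
  moreover have "1 - c = (1 / (1 + 2 * \<eta>)) *\<^sub>R ((1 + \<eta>) *\<^sub>R 1 - s)"
  proof -
    have "1 = (1 / (1 + 2 * \<eta>)) *\<^sub>R ((1 + 2 * \<eta>) *\<^sub>R (1::'a))" using \<eta> by simp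
    then have "1 - c = (1 / (1 + 2 * \<eta>)) *\<^sub>R ((1 + 2 * \<eta>) *\<^sub>R 1 - (s + \<eta> *\<^sub>R 1))"
      unfolding c_def scaleR_diff_right by metis
    also have "(1 + 2 * \<eta>) *\<^sub>R (1::'a) = (1 + \<eta>) *\<^sub>R 1 + \<eta> *\<^sub>R 1"
      by (simp only: scaleR_add_left[symmetric]) (simp add: algebra_simps)
    then have "(1 + 2 * \<eta>) *\<^sub>R 1 - (s + \<eta> *\<^sub>R 1) = (1 + \<eta>) *\<^sub>R 1 - s" by simp
    finally show ?thesis .
  qed
  then have "norm (1 - c) \<le> 1" using key \<eta> by simp
  moreover have "adj c = c" by (simp add: c_def adj_scaleR adj_add s_sa)
  ultimately have "positive_contraction c" by (simp add: positive_contraction_iff)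
  moreover have "norm (c - a * b) \<le> 5 * \<eta>"
  proof -
    have "(1 + 2 * \<eta>) *\<^sub>R c = s + \<eta> *\<^sub>R 1" using \<eta> by (simp add: c_def)
    then have eq: "(1 + 2 * \<eta>) *\<^sub>R (c - a * b) = \<eta> *\<^sub>R a + (e + (\<eta> *\<^sub>R 1 + (- 2 * \<eta>) *\<^sub>R (a * b)))"
      by (simp add: scaleR_diff_right s_eq distrib_left scaleR_add_left)
    have ab: "norm (a * b) \<le> 1"
      using order_trans[OF norm_mult_ineq mult_mono[OF a'(2) b'(2)]] by simp
    have "norm (\<eta> *\<^sub>R a + (e + (\<eta> *\<^sub>R 1 + (- 2 * \<eta>) *\<^sub>R (a * b)))) \<le> \<bar>\<eta>\<bar> + (\<eta>\<^sup>2 / 2 + (\<bar>\<eta>\<bar> + \<bar>- 2 * \<eta>\<bar>))"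
      by (intro norm_triangle_mono norm_scaleR_le_one_mult a' ab norm_one_le less_imp_le[OF e])
    also have "\<dots> \<le> 5 * \<eta>"
      using \<eta> mult_left_mono[OF \<eta>(2), of \<eta>] by (simp add: power2_eq_square)
    finally have "(1 + 2 * \<eta>) * norm (c - a * b) \<le> 5 * \<eta>"
      using \<eta> unfolding eq[symmetric] by simp
    moreover have "norm (c - a * b) \<le> (1 + 2 * \<eta>) * norm (c - a * b)"
      using \<eta> by (simp add: mult_le_cancel_right1)
    ultimately show ?thesis by linarith
  qed
  ultimately show ?thesis by blast
qed

lemma near_product_uniform:
  assumes "\<epsilon> > 0"
  shows "\<exists>\<delta>>0. \<forall>a b :: 'a::unital_cstar_algebra. positive_contraction a \<longrightarrow> positive_contraction b \<longrightarrow>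
    norm (commutator a b) < \<delta> \<longrightarrow> (\<exists>c. positive_contraction c \<and> norm (c - a * b) < \<epsilon>)"
proof -
  define \<eta> where "\<eta> = min 1 (\<epsilon> / 6)"
  have \<eta>: "0 < \<eta>" "\<eta> \<le> 1" "5 * \<eta> < \<epsilon>" using assms by (auto simp: \<eta>_def min_def)
  show ?thesis
  proof (intro exI[of _ "\<eta>\<^sup>2"] conjI allI impI)
    fix a b :: 'a
    assume "positive_contraction a" "positive_contraction b" "norm (commutator a b) < \<eta>\<^sup>2"
    then obtain c where "positive_contraction c" "norm (c - a * b) \<le> 5 * \<eta>"
      using near_product[OF _ _ \<eta>(1,2)] unfolding commutator_def by blast
    then show "\<exists>c. positive_contraction c \<and> norm (c - a * b) < \<epsilon>" using \<eta>(3) by force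
  qed (use \<eta> in simp)
qed

section \<open>Estimates for products of contractions\<close>

lemma norm_mult_le: "norm x \<le> r \<Longrightarrow> norm y \<le> s \<Longrightarrow> norm (x * y) \<le> r * s"
  for x y :: "'a::real_normed_algebra"
  by (rule order_trans[OF norm_mult_ineq mult_mono]) (auto intro: order_trans[OF norm_ge_zero])

lemma norm_diff_mult_le:
  fixes x y :: "'a::real_normed_algebra"
  assumes "norm y \<le> 1" and "norm x' \<le> 1"
  shows "norm (x * y - x' * y') \<le> norm (x - x') + norm (y - y')"
proof -
  have "x * y - x' * y' = (x - x') * y + x' * (y - y')" by (simp add: algebra_simps)
  moreover have "norm ((x - x') * y) \<le> norm (x - x') * 1" "norm (x' * (y - y')) \<le> 1 * norm (y - y')"
    by (rule norm_mult_le; use assms in simp)+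
  ultimately show ?thesis using norm_triangle_mono by fastforce
qed

text \<open>
  Interchanging the two middle factors costs a commutator and pairs \<open>a\<close> with \<open>a'\<close> and \<open>b\<close> with \<open>b'\<close>.
\<close>

lemma norm_product_interchange:
  fixes a b a' b' :: "'a::unital_cstar_algebra"
  assumes "norm a \<le> 1" and "norm b' \<le> 1"
  shows "norm ((a * b) * (a' * b')) \<le> norm (commutator a' b) + norm (a * a') * norm (b * b')"
proof -
  have "(a * b) * (a' * b') = - (a * commutator a' b * b') + (a * a') * (b * b')"
    by (simp add: commutator_def algebra_simps)
  moreover have "norm (a * commutator a' b * b') \<le> 1 * norm (commutator a' b) * 1"
    by (intro norm_mult_le) (use assms in auto)
  ultimately show ?thesis
    using norm_triangle_mono[of "- (a * commutator a' b * b')"] norm_mult_ineq[of "a * a'" "b * b'"] by simp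
qed

lemma commutator_product_le:
  fixes a b x :: "'a::unital_cstar_algebra"
  assumes "norm a \<le> 1" and "norm b \<le> 1"
  shows "norm (commutator (a * b) x) \<le> norm (commutator a x) + norm (commutator b x)"
proof -
  have "commutator (a * b) x = commutator a x * b + a * commutator b x"
    by (simp add: commutator_def algebra_simps)
  moreover have "norm (commutator a x * b) \<le> norm (commutator a x) * 1"
      "norm (a * commutator b x) \<le> 1 * norm (commutator b x)"
    by (rule norm_mult_le; use assms in simp)+
  ultimately show ?thesis using norm_triangle_mono by fastforce
qed

lemma commutator_perturb_le:
  fixes c p x :: "'a::unital_cstar_algebra"
  shows "norm (commutator c x) \<le> 2 * norm (c - p) * norm x + norm (commutator p x)"
proof -
  have "commutator c x = ((c - p) * x - x * (c - p)) + commutator p x"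
    by (simp add: commutator_def algebra_simps)
  moreover have "norm ((c - p) * x - x * (c - p)) \<le> norm (c - p) * norm x + norm x * norm (c - p)"
    by (intro norm_triangle_le_diff add_mono norm_mult_ineq)
  ultimately show ?thesis
    using norm_triangle_mono[of "(c - p) * x - x * (c - p)" "2 * norm (c - p) * norm x" "commutator p x"]
    by (simp add: mult.commute)
qed

section \<open>Boxes supported on a set of directions\<close>

text \<open>
  Vectors supported on \<open>S\<close> stand for points of a box whose dimension is the cardinality of \<open>S\<close>. Keeping
  them in the full lattice lets an induction over \<open>S\<close> stay within one type.
\<close>

definition sub_box :: "'m::finite set \<Rightarrow> nat \<Rightarrow> (int ^ 'm) set" where
  "sub_box S n = {v. \<forall>i. if i \<in> S then 0 \<le> v $ i \<and> v $ i < int n else v $ i = 0}"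

text \<open>
  Coordinates outside \<open>S\<close> are erased, so a translation in a direction outside \<open>S\<close> becomes the identity
  on the box. Shift-equivariance in the directions of \<open>S\<close> and invariance in the others are thereby
  one and the same condition.
\<close>

definition sub_mod :: "'m::finite set \<Rightarrow> nat \<Rightarrow> int ^ 'm \<Rightarrow> int ^ 'm" where
  "sub_mod S n v = (\<chi> i. if i \<in> S then v $ i mod int n else 0)"

definition forget :: "'m::finite \<Rightarrow> int ^ 'm \<Rightarrow> int ^ 'm" where
  "forget i v = (\<chi> j. if j = i then 0 else v $ j)"

lemma sub_mod_in_sub_box: "n \<ge> 1 \<Longrightarrow> sub_mod S n v \<in> sub_box S n"
  by (auto simp: sub_box_def sub_mod_def)

lemma bij_betw_sub_box_insert:
  assumes "i \<notin> S"
  shows "bij_betw (\<lambda>v. (forget i v, nat (v $ i))) (sub_box (insert i S) n) (sub_box S n \<times> {..<n})"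
proof (rule bij_betwI[where g="\<lambda>(u, k). u + axis i (int k)"])
  show "(\<lambda>v. (forget i v, nat (v $ i))) \<in> sub_box (insert i S) n \<rightarrow> sub_box S n \<times> {..<n}"
    using assms by (auto simp: sub_box_def forget_def split: if_splits)
  show "(\<lambda>(u, k). u + axis i (int k)) \<in> sub_box S n \<times> {..<n} \<rightarrow> sub_box (insert i S) n"
    using assms by (force simp: sub_box_def axis_def split: if_splits)
  show "(\<lambda>(u, k). u + axis i (int k)) (forget i v, nat (v $ i)) = v"
    if "v \<in> sub_box (insert i S) n" for v
    using that by (auto simp: sub_box_def forget_def axis_def vec_eq_iff)
  show "(forget i ((\<lambda>(u, k). u + axis i (int k)) p), nat (((\<lambda>(u, k). u + axis i (int k)) p) $ i)) = p"
    if "p \<in> sub_box S n \<times> {..<n}" for p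
    using that assms by (cases p) (force simp: sub_box_def forget_def axis_def vec_eq_iff)
qed

lemma finite_sub_box: "finite (sub_box S n :: (int ^ 'm::finite) set)"
proof -
  have "finite S" by simp
  then show ?thesis
  proof (induction S)
    case empty
    have "sub_box {} n \<subseteq> {0 :: int ^ 'm}" by (auto simp: sub_box_def vec_eq_iff)
    then show ?case by (rule finite_subset) simp
  next
    case (insert i S)
    then show ?case using bij_betw_finite[OF bij_betw_sub_box_insert[OF insert.hyps(2)]] by simp
  qed
qed

lemma forget_sub_mod:
  assumes "i \<notin> S"
  shows "forget i (sub_mod (insert i S) n (v + axis j 1)) = sub_mod S n (forget i v + axis j 1)"
  using assms by (auto simp: forget_def sub_mod_def axis_def vec_eq_iff)

lemma coord_sub_mod:
  assumes "v \<in> sub_box (insert i S) n"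
  shows "nat (sub_mod (insert i S) n (v + axis j 1) $ i) =
    (if j = i then (nat (v $ i) + 1) mod n else nat (v $ i))"
proof -
  have v: "0 \<le> v $ i" "v $ i < int n" using assms by (auto simp: sub_box_def dest: spec[of _ i])
  show ?thesis
  proof (cases "j = i")
    case True
    have "nat ((v $ i + 1) mod int n) = (nat (v $ i) + 1) mod n"
      using v by (simp add: nat_mod_distrib nat_add_distrib)
    then show ?thesis using True by (simp add: sub_mod_def axis_def)
  next
    case False
    then show ?thesis using v by (simp add: sub_mod_def axis_def)
  qed
qed

lemma sum_div_mod:
  fixes h :: "nat \<Rightarrow> nat \<Rightarrow> 'a::comm_monoid_add"
  assumes "D > 0"
  shows "(\<Sum>L<N * D. h (L div D) (L mod D)) = (\<Sum>l<N. \<Sum>l'<D. h l l')"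
  unfolding sum.cartesian_product
proof (rule sum.reindex_bij_witness[where i="\<lambda>(l, l'). l * D + l'" and j="\<lambda>L. (L div D, L mod D)"])
  fix p assume "p \<in> {..<N} \<times> {..<D}"
  then obtain l l' where p: "p = (l, l')" "l < N" "l' < D" by auto
  have "l * D + l' < l * D + D" using p by simp
  also have "\<dots> = Suc l * D" by simp
  also have "\<dots> \<le> N * D" using p by (intro mult_le_mono1) simp
  finally show "(case p of (l, l') \<Rightarrow> l * D + l') \<in> {..<N * D}" using p by simp
qed (use assms in \<open>auto simp: less_mult_imp_div_less\<close>)

lemma positive_contraction_norm: "positive_contraction a \<Longrightarrow> norm a \<le> 1"
  by (simp add: positive_contraction_def)

lemma positive_contraction_one: "positive_contraction (1 :: 'a::unital_cstar_algebra)"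
  by (simp add: positive_contraction_iff norm_one_le)

section \<open>From generators to arbitrary group elements\<close>

lemma group_action_zero: "group_action \<alpha> \<Longrightarrow> \<alpha> 0 x = x"
proof -
  assume g: "group_action \<alpha>"
  have "\<alpha> 0 (\<alpha> 0 x) = \<alpha> 0 x"
    using g unfolding group_action_def by (metis add.right_neutral comp_apply)
  moreover have "inj (\<alpha> 0)"
    using g unfolding group_action_def star_automorphism_def by (auto intro: bij_is_inj)
  ultimately show "\<alpha> 0 x = x" by (auto dest: injD)
qed

text \<open>
  An error of \<open>\<epsilon>\<close> on the generators accumulates along a word for \<open>w\<close>, because every \<open>\<alpha> v\<close> is
  contractive. The constant depends on \<open>w\<close> alone, so for finitely many \<open>w\<close> the towers can be chosen
  afterwards. The property is closed under sums and negation and holds for the generators.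
\<close>

lemma group_action_word:
  fixes \<alpha> :: "int ^ 'm::finite \<Rightarrow> 'a::unital_cstar_algebra \<Rightarrow> 'a"
  assumes g: "group_action \<alpha>" and n: "n \<ge> 1"
  shows "\<exists>C\<ge>0. \<forall>\<epsilon> (f :: int ^ 'm \<Rightarrow> 'a). (\<forall>v\<in>rok_box n. \<forall>j. norm (\<alpha> (axis j 1) (f v) - f (vmod (v + axis j 1) n)) \<le> \<epsilon>) \<longrightarrow>
    (\<forall>v\<in>rok_box n. norm (\<alpha> w (f v) - f (vmod (v + w) n)) \<le> C * \<epsilon>)"
    (is "?P w")
proof -
  have auto: "star_automorphism (\<alpha> v)" and add: "\<alpha> (v + w) x = \<alpha> v (\<alpha> w x)" for v w x
    using g by (simp_all add: group_action_def)
  have contr: "norm (\<alpha> v x - \<alpha> v y) \<le> norm (x - y)" for v x y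
    using star_automorphism_contractive[OF auto, of v "x - y"] by (simp add: star_automorphism_diff[OF auto])
  have box: "vmod v n \<in> rok_box n" for v :: "int ^ 'm"
    using n by (auto simp: vmod_def rok_box_def)
  have vmod_box: "vmod v n = v" if "v \<in> rok_box n" for v :: "int ^ 'm"
    using that by (auto simp: vmod_def rok_box_def vec_eq_iff)
  have vmod_add: "vmod (vmod v n + w) n = vmod (v + w) n" for v w :: "int ^ 'm"
    by (simp add: vmod_def vec_eq_iff mod_add_left_eq)
  have P0: "?P 0"
    by (intro exI[of _ 0]) (auto simp: group_action_zero[OF g] vmod_box)
  have Padd: "?P (w + w')" if w: "?P w" and w': "?P w'" for w w'
  proof -
    obtain C where C: "C \<ge> 0" "\<And>\<epsilon> (f :: int ^ 'm \<Rightarrow> 'a) v. \<forall>v\<in>rok_box n. \<forall>j. norm (\<alpha> (axis j 1) (f v) - f (vmod (v + axis j 1) n)) \<le> \<epsilon>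
        \<Longrightarrow> v \<in> rok_box n \<Longrightarrow> norm (\<alpha> w (f v) - f (vmod (v + w) n)) \<le> C * \<epsilon>"
      using w by blast
    obtain C' where C': "C' \<ge> 0" "\<And>\<epsilon> (f :: int ^ 'm \<Rightarrow> 'a) v. \<forall>v\<in>rok_box n. \<forall>j. norm (\<alpha> (axis j 1) (f v) - f (vmod (v + axis j 1) n)) \<le> \<epsilon>
        \<Longrightarrow> v \<in> rok_box n \<Longrightarrow> norm (\<alpha> w' (f v) - f (vmod (v + w') n)) \<le> C' * \<epsilon>"
      using w' by blast
    show ?thesis
    proof (intro exI[of _ "C + C'"] conjI allI impI ballI)
      fix \<epsilon> and f :: "int ^ 'm \<Rightarrow> 'a" and v :: "int ^ 'm"
      assume f: "\<forall>v\<in>rok_box n. \<forall>j. norm (\<alpha> (axis j 1) (f v) - f (vmod (v + axis j 1) n)) \<le> \<epsilon>"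
        and v: "v \<in> rok_box n"
      let ?u = "vmod (v + w') n"
      have "norm (\<alpha> w (\<alpha> w' (f v)) - \<alpha> w (f ?u)) \<le> C' * \<epsilon>"
        using contr C'(2)[OF f v] order_trans by blast
      moreover have "norm (\<alpha> w (f ?u) - f (vmod (?u + w) n)) \<le> C * \<epsilon>"
        using C(2)[OF f box] .
      moreover have "vmod (?u + w) n = vmod (v + (w + w')) n" by (simp only: vmod_add) (simp add: add_ac)
      ultimately show "norm (\<alpha> (w + w') (f v) - f (vmod (v + (w + w')) n)) \<le> (C + C') * \<epsilon>"
        using norm_triangle_mono[of "\<alpha> w (\<alpha> w' (f v)) - \<alpha> w (f ?u)" "C' * \<epsilon>"
            "\<alpha> w (f ?u) - f (vmod (?u + w) n)" "C * \<epsilon>"]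
        by (simp add: add distrib_right)
    qed (use C C' in simp)
  qed
  have Pneg: "?P (- w)" if w: "?P w" for w
  proof -
    obtain C where C: "C \<ge> 0" "\<And>\<epsilon> (f :: int ^ 'm \<Rightarrow> 'a) v. \<forall>v\<in>rok_box n. \<forall>j. norm (\<alpha> (axis j 1) (f v) - f (vmod (v + axis j 1) n)) \<le> \<epsilon>
        \<Longrightarrow> v \<in> rok_box n \<Longrightarrow> norm (\<alpha> w (f v) - f (vmod (v + w) n)) \<le> C * \<epsilon>"
      using w by blast
    show ?thesis
    proof (intro exI[of _ C] conjI allI impI ballI)
      fix \<epsilon> and f :: "int ^ 'm \<Rightarrow> 'a" and v :: "int ^ 'm"
      assume f: "\<forall>v\<in>rok_box n. \<forall>j. norm (\<alpha> (axis j 1) (f v) - f (vmod (v + axis j 1) n)) \<le> \<epsilon>"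
        and v: "v \<in> rok_box n"
      let ?u = "vmod (v + - w) n"
      have u: "vmod (?u + w) n = v" by (simp add: vmod_add vmod_box[OF v])
      have "norm (\<alpha> (- w) (f v) - \<alpha> (- w) (\<alpha> w (f ?u))) \<le> C * \<epsilon>"
        using contr[of "- w" "f v" "\<alpha> w (f ?u)"] C(2)[OF f box, of "v + - w"] unfolding u
        by (metis norm_minus_commute order_trans)
      moreover have "\<alpha> (- w) (\<alpha> w (f ?u)) = f ?u"
        using add[of "- w" w] by (simp add: group_action_zero[OF g])
      ultimately show "norm (\<alpha> (- w) (f v) - f ?u) \<le> C * \<epsilon>" by simp
    qed (use C in simp)
  qed
  have P1: "?P (axis j 1)" for j by (intro exI[of _ 1]) auto
  have Pnat: "?P (axis j (int k))" for j k
  proof (induction k)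
    case 0
    have "axis j (int 0) = (0 :: int ^ 'm)" by (simp add: axis_def vec_eq_iff)
    then show ?case using P0 by (simp only:)
  next
    case (Suc k)
    have "axis j (int (Suc k)) = axis j (int k) + (axis j 1 :: int ^ 'm)" by (simp add: axis_def vec_eq_iff)
    then show ?case using Padd[OF Suc P1[of j]] by simp
  qed
  have Pint: "?P (axis j z)" for j z
  proof (cases "z \<ge> 0")
    case True
    then show ?thesis using Pnat[of j "nat z"] by simp
  next
    case False
    then have "axis j z = - (axis j (int (nat (- z))) :: int ^ 'm)" by (simp add: axis_def vec_eq_iff)
    then show ?thesis using Pneg[OF Pnat[of j "nat (- z)"]] by simp
  qed
  have Psum: "?P (\<Sum>j\<in>J. axis j (w $ j))" for J
  proof (induction J rule: infinite_finite_induct)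
    case (insert j J)
    then show ?case using Padd[OF Pint[of j "w $ j"] insert.IH] by simp
  qed (use P0 in simp_all)
  have "(\<Sum>j\<in>UNIV. axis j (w $ j)) = w"
    by (simp add: vec_eq_iff axis_def)
  with Psum[of UNIV] show ?thesis by (simp only:)
qed

section \<open>Combining towers in several directions\<close>

definition towers ::
    "(int ^ 'm::finite \<Rightarrow> 'a::unital_cstar_algebra \<Rightarrow> 'a) \<Rightarrow> 'm set \<Rightarrow> nat \<Rightarrow> nat \<Rightarrow> 'a set \<Rightarrow> real \<Rightarrow>
      (nat \<Rightarrow> int ^ 'm \<Rightarrow> 'a) \<Rightarrow> bool" where
  "towers \<alpha> S n N F \<epsilon> f \<longleftrightarrow>
     (\<forall>l<N. \<forall>v\<in>sub_box S n. positive_contraction (f l v)) \<and>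
     (\<forall>l<N. \<forall>v\<in>sub_box S n. \<forall>j.
        norm (\<alpha> (axis j 1) (f l v) - f l (sub_mod S n (v + axis j 1))) < \<epsilon>) \<and>
     (\<forall>l<N. \<forall>v\<in>sub_box S n. \<forall>v'\<in>sub_box S n. v \<noteq> v' \<longrightarrow> norm (f l v * f l v') < \<epsilon>) \<and>
     (\<forall>l<N. \<forall>v\<in>sub_box S n. \<forall>a\<in>F. norm (commutator (f l v) a) < \<epsilon>) \<and>
     norm ((\<Sum>l<N. \<Sum>v\<in>sub_box S n. f l v) - 1) < \<epsilon>"

lemma towersD:
  assumes "towers \<alpha> S n N F \<epsilon> f"
  shows "l < N \<Longrightarrow> v \<in> sub_box S n \<Longrightarrow> positive_contraction (f l v)"
    and "l < N \<Longrightarrow> v \<in> sub_box S n \<Longrightarrow>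
      norm (\<alpha> (axis j 1) (f l v) - f l (sub_mod S n (v + axis j 1))) < \<epsilon>"
    and "l < N \<Longrightarrow> v \<in> sub_box S n \<Longrightarrow> v' \<in> sub_box S n \<Longrightarrow> v \<noteq> v' \<Longrightarrow> norm (f l v * f l v') < \<epsilon>"
    and "l < N \<Longrightarrow> v \<in> sub_box S n \<Longrightarrow> a \<in> F \<Longrightarrow> norm (commutator (f l v) a) < \<epsilon>"
    and "norm ((\<Sum>l<N. \<Sum>v\<in>sub_box S n. f l v) - 1) < \<epsilon>"
  using assms unfolding towers_def by simp_all

lemma towers_empty:
  fixes \<alpha> :: "int ^ 'm::finite \<Rightarrow> 'a::unital_cstar_algebra \<Rightarrow> 'a"
  assumes g: "group_action \<alpha>" and "\<epsilon> > 0"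
  shows "towers \<alpha> {} n 1 F \<epsilon> (\<lambda>l v. 1)"
proof -
  have "sub_box {} n = {0 :: int ^ 'm}" by (auto simp: sub_box_def vec_eq_iff)
  moreover have "\<alpha> v 1 = 1" for v using g by (simp add: group_action_def star_automorphism_one)
  ultimately show ?thesis
    using assms by (auto simp: towers_def positive_contraction_one commutator_def)
qed

definition cyclic_towers ::
    "(int ^ 'm::finite \<Rightarrow> 'a::unital_cstar_algebra \<Rightarrow> 'a) \<Rightarrow> 'm \<Rightarrow> nat \<Rightarrow> nat \<Rightarrow> 'a set \<Rightarrow> real \<Rightarrow>
      (nat \<Rightarrow> nat \<Rightarrow> 'a) \<Rightarrow> bool" where
  "cyclic_towers \<alpha> i p d F \<epsilon> g \<longleftrightarrow>
        (\<forall>l\<le>d. \<forall>k<p. positive_contraction (g l k)) \<and>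
        (\<forall>l\<le>d. \<forall>k<p. norm (\<alpha> (axis i 1) (g l k) - g l ((k + 1) mod p)) < \<epsilon>) \<and>
        (\<forall>j. j \<noteq> i \<longrightarrow> (\<forall>l\<le>d. \<forall>k<p. norm (\<alpha> (axis j 1) (g l k) - g l k) < \<epsilon>)) \<and>
        (\<forall>l\<le>d. \<forall>k<p. \<forall>x\<in>F. norm (commutator (g l k) x) < \<epsilon>) \<and>
        (\<forall>l\<le>d. \<forall>k<p. \<forall>n<p. k \<noteq> n \<longrightarrow> norm (g l k * g l n) < \<epsilon>) \<and>
        norm ((\<Sum>l\<le>d. \<Sum>k<p. g l k) - 1) < \<epsilon>"

lemma cyclic_towersD:
  assumes "cyclic_towers \<alpha> i p d F \<epsilon> g"
  shows "l \<le> d \<Longrightarrow> k < p \<Longrightarrow> positive_contraction (g l k)"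
    and "l \<le> d \<Longrightarrow> k < p \<Longrightarrow> norm (\<alpha> (axis i 1) (g l k) - g l ((k + 1) mod p)) < \<epsilon>"
    and "j \<noteq> i \<Longrightarrow> l \<le> d \<Longrightarrow> k < p \<Longrightarrow> norm (\<alpha> (axis j 1) (g l k) - g l k) < \<epsilon>"
    and "l \<le> d \<Longrightarrow> k < p \<Longrightarrow> x \<in> F \<Longrightarrow> norm (commutator (g l k) x) < \<epsilon>"
    and "l \<le> d \<Longrightarrow> k < p \<Longrightarrow> k' < p \<Longrightarrow> k \<noteq> k' \<Longrightarrow> norm (g l k * g l k') < \<epsilon>"
    and "norm ((\<Sum>l\<le>d. \<Sum>k<p. g l k) - 1) < \<epsilon>"
  using assms unfolding cyclic_towers_def by simp_all

text \<open>
  The new towers are positive contractions close to the products of old towers and cyclic towers in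
  direction \<open>i\<close>. The cyclic towers are chosen last and almost commute with the old ones, which were
  added to the finite set \<open>F\<close>. Two products with different indices have almost orthogonal factors of at
  least one kind, and the sum of all products is the product of the two sums.
\<close>

lemma towers_insert:
  fixes \<alpha> :: "int ^ 'm::finite \<Rightarrow> 'a::unital_cstar_algebra \<Rightarrow> 'a"
  assumes act: "group_action \<alpha>" and n: "n \<ge> 1" and i: "i \<notin> S"
    and f_ex: "\<And>F \<epsilon>. finite F \<Longrightarrow> \<epsilon> > 0 \<Longrightarrow> \<exists>f. towers \<alpha> S n N F \<epsilon> f"
    and g_ex: "\<And>F \<epsilon>. finite F \<Longrightarrow> \<epsilon> > 0 \<Longrightarrow> \<exists>g. cyclic_towers \<alpha> i n d F \<epsilon> g"
    and F: "finite F" and \<epsilon>: "\<epsilon> > 0"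
  shows "\<exists>f. towers \<alpha> (insert i S) n (N * (d + 1)) F \<epsilon> f"
proof -
  let ?B = "sub_box (insert i S) n"
  define D where "D = d + 1"
  have D: "D > 0" by (simp add: D_def)
  have le_D: "l \<le> d \<longleftrightarrow> l < D" for l by (auto simp: D_def)
  define M where "M = real (N * D * card ?B) + (\<Sum>x\<in>F. norm x) + 1"
  have M1: "M \<ge> 1" by (simp add: M_def sum_nonneg)
  have MF: "norm x \<le> M" if "x \<in> F" for x
  proof -
    have "norm x \<le> (\<Sum>x\<in>F. norm x)" using member_le_sum[OF that, of norm] F by simp
    moreover have "0 \<le> real (N * D * card ?B)" by (rule of_nat_0_le_iff)
    ultimately show ?thesis unfolding M_def by linarith
  qed
  have MN: "real (N * D * card ?B) \<le> M" by (simp add: M_def sum_nonneg)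
  \<comment> \<open>The distance allowed between a tower and a product; \<open>M\<close> absorbs the number of terms in the sum and the norms in \<open>F\<close>.\<close>
  define \<epsilon>2 where "\<epsilon>2 = \<epsilon> / (4 * M)"
  have \<epsilon>2: "\<epsilon>2 > 0" using \<epsilon> M1 by (simp add: \<epsilon>2_def)
  have M\<epsilon>2: "M * \<epsilon>2 = \<epsilon> / 4" using M1 by (simp add: \<epsilon>2_def)
  have \<epsilon>2_le: "\<epsilon>2 \<le> \<epsilon> / 4" using M\<epsilon>2 mult_right_mono[OF M1 less_imp_le[OF \<epsilon>2]] by simp
  obtain \<delta> where \<delta>: "\<delta> > 0"
      "\<And>a b :: 'a. positive_contraction a \<Longrightarrow> positive_contraction b \<Longrightarrow> norm (commutator a b) < \<delta> \<Longrightarrow>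
        \<exists>c. positive_contraction c \<and> norm (c - a * b) < \<epsilon>2"
    using near_product_uniform[OF \<epsilon>2, where 'a='a] by blast
  define \<epsilon>1 where "\<epsilon>1 = min (min \<delta> 1) (\<epsilon> / 8)"
  have \<epsilon>1: "\<epsilon>1 > 0" "\<epsilon>1 \<le> \<delta>" "\<epsilon>1 \<le> 1" "\<epsilon>1 \<le> \<epsilon> / 8" using \<delta> \<epsilon> by (auto simp: \<epsilon>1_def)
  obtain f where f: "towers \<alpha> S n N F \<epsilon>1 f" using f_ex[OF F \<epsilon>1(1)] by blast
  define G where "G = F \<union> (\<lambda>(l, u). f l u) ` ({..<N} \<times> sub_box S n)"
  have "finite G" using F by (simp add: G_def finite_sub_box)
  then obtain g where g: "cyclic_towers \<alpha> i n d G \<epsilon>1 g" using g_ex[OF _ \<epsilon>1(1)] by blast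
  note f' = towersD[OF f] and g' = cyclic_towersD[OF g, unfolded le_D]
  have f_pc: "positive_contraction (f l u)" if "l < N" "u \<in> sub_box S n" for l u
    using f'(1)[OF that] .
  have g_pc: "positive_contraction (g l k)" if "l < D" "k < n" for l k
    using g'(1)[OF that] .
  have fg_comm: "norm (commutator (f l u) (g l' k)) < \<epsilon>1"
    if "l < N" "u \<in> sub_box S n" "l' < D" "k < n" for l u l' k
  proof -
    have "f l u \<in> G" using that by (auto simp: G_def)
    then have "norm (commutator (g l' k) (f l u)) < \<epsilon>1" using g'(4)[OF that(3,4)] by blast
    then show "norm (commutator (f l u) (g l' k)) < \<epsilon>1" by (simp add: commutator_def norm_minus_commute)
  qed
  define A where "A L v = f (L div D) (forget i v)" for L v
  define B where "B L v = g (L mod D) (nat (v $ i))" for L v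
  have idx: "L div D < N" "L mod D < D" if "L < N * D" for L
    using that D by (simp_all add: less_mult_imp_div_less)
  have pos: "forget i v \<in> sub_box S n" "nat (v $ i) < n" if "v \<in> ?B" for v
    using bij_betwE[OF bij_betw_sub_box_insert[OF i, of n]] that by auto
  have A_pc: "positive_contraction (A L v)" and B_pc: "positive_contraction (B L v)"
    if "L < N * D" "v \<in> ?B" for L v
    unfolding A_def B_def using that by (auto intro: f_pc g_pc idx pos)
  have AB_comm: "norm (commutator (A L v) (B L v')) < \<epsilon>1"
    if "L < N * D" "v \<in> ?B" "v' \<in> ?B" for L v v'
    unfolding A_def B_def using that by (auto intro: fg_comm idx pos)
  have "\<exists>c. positive_contraction c \<and> norm (c - A L v * B L v) < \<epsilon>2" if "L < N * D" "v \<in> ?B" for L v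
    by (rule \<delta>(2)[OF A_pc[OF that] B_pc[OF that] less_le_trans[OF AB_comm[OF that that(2)] \<epsilon>1(2)]])
  then obtain c where c: "\<And>L v. L < N * D \<Longrightarrow> v \<in> ?B \<Longrightarrow>
      positive_contraction (c L v) \<and> norm (c L v - A L v * B L v) < \<epsilon>2"
    by metis
  have nA: "norm (A L v) \<le> 1" and nB: "norm (B L v) \<le> 1" and nc: "norm (c L v) \<le> 1"
    if "L < N * D" "v \<in> ?B" for L v
    using that A_pc B_pc c by (auto intro: positive_contraction_norm)
  have nAB: "norm (A L v * B L v) \<le> 1" if "L < N * D" "v \<in> ?B" for L v
    using norm_mult_le[OF nA[OF that] nB[OF that]] by simp
  have "towers \<alpha> (insert i S) n (N * D) F \<epsilon> c"
    unfolding towers_def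
  proof (intro conjI allI impI ballI)
    fix L v assume L: "L < N * D" and v: "v \<in> ?B"
    show "positive_contraction (c L v)" using c[OF L v] by blast
  next
    fix L v j assume L: "L < N * D" and v: "v \<in> ?B"
    let ?e = "axis j 1 :: int ^ 'm" and ?w = "sub_mod (insert i S) n (v + axis j 1)"
    have w: "?w \<in> ?B" using n by (rule sub_mod_in_sub_box)
    have auto: "star_automorphism (\<alpha> ?e)" using act by (simp add: group_action_def)
    have contr: "norm (\<alpha> ?e x) \<le> norm x" for x by (rule star_automorphism_contractive[OF auto])
    have 1: "norm (\<alpha> ?e (A L v) - A L ?w) < \<epsilon>1"
      unfolding A_def forget_sub_mod[OF i] using f'(2)[OF idx(1)[OF L] pos(1)[OF v]] .
    have 2: "norm (\<alpha> ?e (B L v) - B L ?w) < \<epsilon>1"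
      unfolding B_def coord_sub_mod[OF v]
      using g'(2)[OF idx(2)[OF L] pos(2)[OF v]]
        g'(3)[OF _ idx(2)[OF L] pos(2)[OF v]] by simp
    have "norm (\<alpha> ?e (B L v)) \<le> 1" using contr nB[OF L v] order_trans by blast
    then have 3: "norm (\<alpha> ?e (A L v * B L v) - A L ?w * B L ?w) \<le> 2 * \<epsilon>1"
      using norm_diff_mult_le[of "\<alpha> ?e (B L v)" "A L ?w" "\<alpha> ?e (A L v)" "B L ?w"] nA[OF L w] 1 2 auto
      by (simp add: star_automorphism_def)
    have 4: "norm (\<alpha> ?e (c L v) - \<alpha> ?e (A L v * B L v)) \<le> \<epsilon>2"
      using contr[of "c L v - A L v * B L v"] c[OF L v] by (simp add: star_automorphism_diff[OF auto])
    have 5: "norm (A L ?w * B L ?w - c L ?w) \<le> \<epsilon>2"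
      using c[OF L w] by (simp add: norm_minus_commute)
    have "norm (\<alpha> ?e (c L v) - c L ?w) \<le> \<epsilon>2 + (2 * \<epsilon>1 + \<epsilon>2)"
      using norm_triangle_mono[OF 4 norm_triangle_mono[OF 3 5]] by simp
    also have "\<dots> < \<epsilon>" using \<epsilon>1 \<epsilon>2_le \<epsilon> by linarith
    finally show "norm (\<alpha> ?e (c L v) - c L ?w) < \<epsilon>" .
  next
    fix L v v' assume L: "L < N * D" and v: "v \<in> ?B" "v' \<in> ?B" "v \<noteq> v'"
    have "(forget i v, nat (v $ i)) \<noteq> (forget i v', nat (v' $ i))"
      using bij_betw_imp_inj_on[OF bij_betw_sub_box_insert[OF i, of n]] v by (auto dest: inj_onD)
    then have "norm (A L v * A L v') < \<epsilon>1 \<or> norm (B L v * B L v') < \<epsilon>1"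
      unfolding A_def B_def
      using f'(3)[OF idx(1)[OF L] pos(1)[OF v(1)] pos(1)[OF v(2)]]
        g'(5)[OF idx(2)[OF L] pos(2)[OF v(1)] pos(2)[OF v(2)]] by blast
    moreover have "norm (A L v * A L v') \<le> 1" "norm (B L v * B L v') \<le> 1"
      using norm_mult_le[OF nA[OF L v(1)] nA[OF L v(2)]] norm_mult_le[OF nB[OF L v(1)] nB[OF L v(2)]] by simp_all
    ultimately have 1: "norm (A L v * A L v') * norm (B L v * B L v') \<le> \<epsilon>1"
      using mult_left_le mult_left_le_one_le by (smt (verit) norm_ge_zero)
    have 2: "norm ((A L v * B L v) * (A L v' * B L v')) \<le> \<epsilon>1 + \<epsilon>1"
      using norm_product_interchange[OF nA[OF L v(1)] nB[OF L v(2)], of "B L v" "A L v'"] 1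
        AB_comm[OF L v(2,1)] by linarith
    have 3: "norm (c L v * c L v' - (A L v * B L v) * (A L v' * B L v')) \<le> \<epsilon>2 + \<epsilon>2"
      using norm_diff_mult_le[OF nc[OF L v(2)] nAB[OF L v(1)], of "c L v" "A L v' * B L v'"]
        c[OF L v(1)] c[OF L v(2)] by linarith
    have "norm (c L v * c L v') \<le> (\<epsilon>2 + \<epsilon>2) + (\<epsilon>1 + \<epsilon>1)"
      using norm_triangle_mono[OF 3 2] by simp
    also have "\<dots> < \<epsilon>" using \<epsilon>1 \<epsilon>2_le \<epsilon> by linarith
    finally show "norm (c L v * c L v') < \<epsilon>" .
  next
    fix L v x assume L: "L < N * D" and v: "v \<in> ?B" and x: "x \<in> F"
    have 1: "norm (commutator (A L v) x) < \<epsilon>1"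
      unfolding A_def using f'(4)[OF idx(1)[OF L] pos(1)[OF v] x] .
    have "x \<in> G" using x by (simp add: G_def)
    then have 2: "norm (commutator (B L v) x) < \<epsilon>1"
      unfolding B_def using g'(4)[OF idx(2)[OF L] pos(2)[OF v]] by blast
    have "norm (c L v - A L v * B L v) * norm x \<le> \<epsilon>2 * M"
      using c[OF L v] MF[OF x] by (intro mult_mono) (auto intro: less_imp_le \<epsilon>2)
    then have 3: "2 * norm (c L v - A L v * B L v) * norm x \<le> \<epsilon> / 2"
      using M\<epsilon>2 by (simp add: mult.commute)
    show "norm (commutator (c L v) x) < \<epsilon>"
      using commutator_perturb_le[of "c L v" x "A L v * B L v"] 1 2 3 \<epsilon>1 \<epsilon>
        commutator_product_le[OF nA[OF L v] nB[OF L v], of x] by linarith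
  next
    define s where "s = (\<Sum>l<N. \<Sum>u\<in>sub_box S n. f l u)"
    define t where "t = (\<Sum>l<D. \<Sum>k<n. g l k)"
    have s: "norm (s - 1) < \<epsilon>1" using f'(5) by (simp only: s_def)
    have t: "norm (t - 1) < \<epsilon>1"
      using cyclic_towersD(6)[OF g] by (simp add: t_def D_def lessThan_Suc_atMost)
    have "(\<Sum>L<N * D. \<Sum>v\<in>?B. A L v * B L v)
        = (\<Sum>L<N * D. (\<lambda>l l'. \<Sum>v\<in>?B. f l (forget i v) * g l' (nat (v $ i))) (L div D) (L mod D))"
      by (simp add: A_def B_def)
    also have "\<dots> = (\<Sum>l<N. \<Sum>l'<D. \<Sum>v\<in>?B. f l (forget i v) * g l' (nat (v $ i)))"
      by (rule sum_div_mod[OF D])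
    also have "\<dots> = (\<Sum>l<N. \<Sum>l'<D. \<Sum>u\<in>sub_box S n. \<Sum>k<n. f l u * g l' k)"
    proof (rule sum.cong[OF refl], rule sum.cong[OF refl])
      fix l l'
      show "(\<Sum>v\<in>?B. f l (forget i v) * g l' (nat (v $ i))) = (\<Sum>u\<in>sub_box S n. \<Sum>k<n. f l u * g l' k)"
        using sum.reindex_bij_betw[OF bij_betw_sub_box_insert[OF i, of n], of "\<lambda>(u, k). f l u * g l' k"]
        by (simp add: sum.cartesian_product)
    qed
    also have "\<dots> = s * t"
      by (simp only: s_def t_def sum_product)
    finally have AB: "(\<Sum>L<N * D. \<Sum>v\<in>?B. A L v * B L v) = s * t" .
    have "norm ((\<Sum>L<N * D. \<Sum>v\<in>?B. c L v) - s * t) \<le> (\<Sum>L<N * D. \<Sum>v\<in>?B. \<epsilon>2)"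
      unfolding AB[symmetric] sum_subtractf[symmetric]
      by (intro sum_norm_le) (use c less_imp_le in blast)
    also have "\<dots> = real (N * D * card ?B) * \<epsilon>2" by simp
    also have "\<dots> \<le> M * \<epsilon>2" using MN \<epsilon>2 by (intro mult_right_mono) auto
    finally have 1: "norm ((\<Sum>L<N * D. \<Sum>v\<in>?B. c L v) - s * t) \<le> \<epsilon> / 4" using M\<epsilon>2 by simp
    have st: "s * t - 1 = (s - 1) * (t - 1) + ((s - 1) + (t - 1))" by (simp add: algebra_simps)
    have "norm ((s - 1) * (t - 1)) \<le> \<epsilon>1 * 1"
      using s t \<epsilon>1 by (intro norm_mult_le) auto
    then have "norm ((s - 1) * (t - 1)) \<le> \<epsilon>1" by simp
    then have 2: "norm (s * t - 1) \<le> \<epsilon>1 + (\<epsilon>1 + \<epsilon>1)"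
      unfolding st by (intro norm_triangle_mono less_imp_le[OF s] less_imp_le[OF t])
    have "norm ((\<Sum>L<N * D. \<Sum>v\<in>?B. c L v) - 1) \<le> \<epsilon> / 4 + (\<epsilon>1 + (\<epsilon>1 + \<epsilon>1))"
      using norm_triangle_mono[OF 1 2] by simp
    also have "\<dots> < \<epsilon>" using \<epsilon>1 \<epsilon> by linarith
    finally show "norm ((\<Sum>L<N * D. \<Sum>v\<in>?B. c L v) - 1) < \<epsilon>" .
  qed
  then show ?thesis unfolding D_def by (rule exI[where x=c])
qed

lemma towers_all_directions:
  fixes \<alpha> :: "int ^ 'm::finite \<Rightarrow> 'a::unital_cstar_algebra \<Rightarrow> 'a"
  assumes act: "group_action \<alpha>" and n: "n \<ge> 1"
    and g_ex: "\<And>i F \<epsilon>. finite F \<Longrightarrow> \<epsilon> > 0 \<Longrightarrow> \<exists>g. cyclic_towers \<alpha> i n d F \<epsilon> g"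
    and "finite F" and "\<epsilon> > 0"
  shows "\<exists>f. towers \<alpha> S n ((d + 1) ^ card S) F \<epsilon> f"
proof -
  have "finite S" by simp
  then show ?thesis using assms(4,5)
  proof (induction S arbitrary: F \<epsilon>)
    case empty
    then show ?case using towers_empty[OF act] by auto
  next
    case (insert i S)
    have "\<exists>f. towers \<alpha> (insert i S) n ((d + 1) ^ card S * (d + 1)) F \<epsilon> f"
      by (rule towers_insert[OF act n insert.hyps(2) insert.IH g_ex insert.prems])
    moreover have "(d + 1) ^ card S * (d + 1) = (d + 1) ^ card (insert i S)"
      using insert.hyps by simp
    ultimately show ?case by (simp only:)
  qed
qed

theorem proposition5p1:
  fixes \<alpha> :: "int ^ 'm::finite \<Rightarrow> 'a::unital_cstar_algebra \<Rightarrow> 'a"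
    and d :: nat
  assumes "group_action \<alpha>"
    and "\<And>(i::'m) (\<epsilon>::real) (p::nat) (F::'a set).
      \<epsilon> > 0 \<Longrightarrow> p \<ge> 1 \<Longrightarrow> finite F \<Longrightarrow>
      \<exists>g :: nat \<Rightarrow> nat \<Rightarrow> 'a.
        (\<forall>l\<le>d. \<forall>k<p. positive_contraction (g l k)) \<and>
        (\<forall>l\<le>d. \<forall>k<p. norm (\<alpha> (axis i 1) (g l k) - g l ((k + 1) mod p)) < \<epsilon>) \<and>
        (\<forall>j. j \<noteq> i \<longrightarrow> (\<forall>l\<le>d. \<forall>k<p. norm (\<alpha> (axis j 1) (g l k) - g l k) < \<epsilon>)) \<and>
        (\<forall>l\<le>d. \<forall>k<p. \<forall>x\<in>F. norm (commutator (g l k) x) < \<epsilon>) \<and>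
        (\<forall>l\<le>d. \<forall>k<p. \<forall>n<p. k \<noteq> n \<longrightarrow> norm (g l k * g l n) < \<epsilon>) \<and>
        norm ((\<Sum>l\<le>d. \<Sum>k<p. g l k) - 1) < \<epsilon>"
  shows "rokhlin_dim_le \<alpha> ((d + 1) ^ CARD('m) - 1)"
  unfolding rokhlin_dim_le_def
proof (intro allI impI)
  fix F :: "'a set" and W :: "(int ^ 'm) set" and \<epsilon> :: real and n :: nat
  assume \<epsilon>: "\<epsilon> > 0" and n: "n \<ge> 1" and F: "finite F" and W: "finite W"
  have box: "rok_box n = (sub_box UNIV n :: (int ^ 'm) set)"
    by (simp add: rok_box_def sub_box_def)
  have vmod: "vmod v n = sub_mod UNIV n v" for v :: "int ^ 'm"
    by (simp add: vmod_def sub_mod_def)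
  obtain C where C: "\<And>w. C w \<ge> 0"
      "\<And>w \<epsilon> f. \<forall>v\<in>rok_box n. \<forall>j. norm (\<alpha> (axis j 1) (f v) - f (vmod (v + axis j 1) n)) \<le> \<epsilon> \<Longrightarrow>
        \<forall>v\<in>rok_box n. norm (\<alpha> w (f v) - f (vmod (v + w) n)) \<le> C w * \<epsilon>"
    using group_action_word[OF assms(1) n] by metis
  define K where "K = (\<Sum>w\<in>W. C w) + 1"
  have K: "K \<ge> 1" "\<And>w. w \<in> W \<Longrightarrow> C w < K"
    using C(1) sum_nonneg[of W C] member_le_sum[of _ W C] W by (force simp: K_def)+
  have \<epsilon>': "\<epsilon> / K > 0" using \<epsilon> K by simp
  have \<epsilon>'_le: "\<epsilon> / K \<le> \<epsilon>" using \<epsilon> K by (simp add: divide_le_eq mult_le_cancel_left1)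
  obtain f where f: "towers \<alpha> UNIV n ((d + 1) ^ CARD('m)) F (\<epsilon> / K) f"
    using towers_all_directions[OF assms(1) n _ F \<epsilon>', of d UNIV] assms(2)[OF _ n]
    unfolding cyclic_towers_def by blast
  let ?D = "(d + 1) ^ CARD('m) - 1"
  have "Suc ?D = (d + 1) ^ CARD('m)" by simp
  then have le: "l \<le> ?D \<longleftrightarrow> l < (d + 1) ^ CARD('m)" for l by linarith
  then have atMost: "{..?D} = {..<(d + 1) ^ CARD('m)}" by auto
  note f' = towersD[OF f, folded le atMost box vmod]
  have shift: "norm (\<alpha> w (f l v) - f l (vmod (v + w) n)) < \<epsilon>"
    if l: "l \<le> ?D" and v: "v \<in> rok_box n" and w: "w \<in> W" for l v w
  proof -
    have "norm (\<alpha> w (f l v) - f l (vmod (v + w) n)) \<le> C w * (\<epsilon> / K)"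
      using C(2)[of "f l" "\<epsilon> / K" w] f'(2)[OF l] v by (meson less_imp_le)
    also have "\<dots> < K * (\<epsilon> / K)" using K(2)[OF w] \<epsilon>' by (rule mult_strict_right_mono)
    finally show ?thesis using K by simp
  qed
  show "\<exists>f :: nat \<Rightarrow> int ^ 'm \<Rightarrow> 'a.
          (\<forall>l\<le>?D. \<forall>v\<in>rok_box n. positive_contraction (f l v)) \<and>
          (\<forall>l\<le>?D. \<forall>v\<in>rok_box n. \<forall>w\<in>W. norm (\<alpha> w (f l v) - f l (vmod (v + w) n)) < \<epsilon>) \<and>
          (\<forall>l\<le>?D. \<forall>v\<in>rok_box n. \<forall>v'\<in>rok_box n. v \<noteq> v' \<longrightarrow> norm (f l v * f l v') < \<epsilon>) \<and>
          (\<forall>l\<le>?D. \<forall>v\<in>rok_box n. \<forall>a\<in>F. norm (commutator (f l v) a) < \<epsilon>) \<and>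
          norm ((\<Sum>l\<le>?D. \<Sum>v\<in>rok_box n. f l v) - 1) < \<epsilon>"
    by (intro exI[of _ f] conjI allI impI ballI f'(1) shift less_le_trans[OF f'(3) \<epsilon>'_le]
        less_le_trans[OF f'(4) \<epsilon>'_le] less_le_trans[OF f'(5) \<epsilon>'_le])
qed

end
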